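(* Let $p>1$ and $h\in(0,1)$ be fixed, let $a_h(x)=1$ for $x\in[0,\tfrac{1-h}{2}]\cup[\tfrac{1+h}{2},1]$ and $a_h(x)=0$ for $x\in(\tfrac{1-h}{2},\tfrac{1+h}{2})$, and consider $$-u''=\lambda u+a_h(x)u^p \ \text{ in } (0,1),\qquad u(0)=u(1)=0. \qquad (P_\lambda)$$ Let $\mathscr{C}_{h,s}^+$ be the component of symmetric positive solutions of $(P_\lambda)$ satisfying $(\pi^2,0)\in\mathscr{C}_{h,s}^+$ and $\mathcal{P}_\lambda(\mathscr{C}_{h,s}^+)=(-\infty,\pi^2]$. Then: (a) for every $(\lambda,u_\lambda)\in\mathscr{C}_{h,s}^+$, either $\lambda=\pi^2$ and $u_\lambda=0$, or $\lambda<\pi^2$ and $u_\lambda$ is the unique symmetric positive solution of $(P_\lambda)$; (b) denoting, for every $\lambda<\pi^2$, by $u_\lambda$ the unique symmetric positive solution of $(P_\lambda)$, for every $\sigma\in(-\infty,\pi^2]$ one has $\lim_{\lambda\to\sigma}\|u_\lambda\|_\infty=0$ if and only if $\sigma=\pi^2$; (c) for each $\lambda_0\in(-\infty,\pi^2)$, the set $\{u_\lambda:\lambda\in[\lambda_0,\pi^2)\}$ is bounded in $\mathcal{C}^1([0,1];\mathbb{R})$, while $\lim_{\lambda\downarrow-\infty}\|u_\lambda\|_\infty=+\infty$; (d) the map $\lambda\mapsto u_\lambda$ is continuous, so that $\mathscr{C}_{h,s}^+=\{(\lambda,u_\lambda):\lambda\in(-\infty,\pi^2]\}$ (with $u_{\pi^2}=0$)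 is a continuous curve. Finally, $\mathscr{C}_{h,s}^+\subset\mathscr{C}_h^+$, where $\mathscr{C}_h^+$ is the component of nontrivial nonnegative solutions of $(P_\lambda)$ containing $(\pi^2,0)$.
   Context: Solutions are functions $u\in\mathcal{C}^1([0,1])$ with $u'$ absolutely continuous satisfying the equation a.e. and the boundary conditions; a positive solution satisfies $u>0$ in $(0,1)$; a solution is symmetric if $u(x)=u(1-x)$ on $[0,1]$. Solution pairs $(\lambda,u)$ are regarded as elements of $\mathbb{R}\times\mathcal{C}([0,1];\mathbb{R})$, and $\mathcal{P}_\lambda(\lambda,u)=\lambda$ is the $\lambda$-projection. "Component" means a maximal closed connected subset of the closure (in $\mathbb{R}\times\mathcal{C}([0,1];\mathbb{R})$) of the relevant set of solution pairs: $\mathscr{C}_{h,s}^+$ is such a component for the set of pairs $(\lambda,u)$ with $u$ a symmetric positive solution (its existence with the stated properties is taken as given), and $\mathscr{C}_h^+$ is the component containing $(\pi^2,0)$ for the set of pairs $(\lambda,u)$ with $u\geq0$, $u\neq0$ a solution. *)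

theory Defs
  imports "HOL-Analysis.Analysis"
begin

definition abs_cont_on :: "real \<Rightarrow> real \<Rightarrow> (real \<Rightarrow> real) \<Rightarrow> bool" where
  "abs_cont_on c d f \<longleftrightarrow>
     (\<forall>\<epsilon>>0. \<exists>\<delta>>0. \<forall>(n::nat) (a::nat \<Rightarrow> real) (b::nat \<Rightarrow> real).
        (\<forall>i<n. c \<le> a i \<and> a i \<le> b i \<and> b i \<le> d) \<longrightarrow>
        (\<forall>i<n. \<forall>j<n. i \<noteq> j \<longrightarrow> b i \<le> a j \<or> b j \<le> a i) \<longrightarrow>
        (\<Sum>i<n. b i - a i) < \<delta> \<longrightarrow>
        (\<Sum>i<n. \<bar>f (b i) - f (a i)\<bar>) < \<epsilon>)"

definition a_h :: "real \<Rightarrow> real \<Rightarrow> real" where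
  "a_h h x = (if x \<in> {0..(1-h)/2} \<union> {(1+h)/2..1} then 1 else 0)"

text \<open>u is a solution of (P_lambda): u is C^1 on [0,1], u' is absolutely continuous on [0,1],
  -u'' = lambda u + a_h u^p a.e. in (0,1), u(0) = u(1) = 0.  The power u^p is rendered as
  u powr p; only nonnegative solutions are considered in the theorem.\<close>
definition is_sol :: "real \<Rightarrow> real \<Rightarrow> real \<Rightarrow> (real \<Rightarrow> real) \<Rightarrow> bool" where
  "is_sol p h lam u \<longleftrightarrow>
     (\<exists>u'. (\<forall>x\<in>{0..1}. (u has_real_derivative u' x) (at x within {0..1})) \<and>
           continuous_on {0..1} u' \<and>
           abs_cont_on 0 1 u' \<and>
           (AE x in lebesgue. x \<in> {0<..<1} \<longrightarrow>
               (u' has_real_derivative - (lam * u x + a_h h x * u x powr p)) (at x))) \<and>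
     u 0 = 0 \<and> u 1 = 0"

definition sym_pos_sol :: "real \<Rightarrow> real \<Rightarrow> real \<Rightarrow> (real \<Rightarrow> real) \<Rightarrow> bool" where
  "sym_pos_sol p h lam u \<longleftrightarrow> is_sol p h lam u \<and> (\<forall>x\<in>{0<..<1}. u x > 0)
      \<and> (\<forall>x\<in>{0..1}. u x = u (1 - x))"

definition nonneg_nontriv_sol :: "real \<Rightarrow> real \<Rightarrow> real \<Rightarrow> (real \<Rightarrow> real) \<Rightarrow> bool" where
  "nonneg_nontriv_sol p h lam u \<longleftrightarrow> is_sol p h lam u \<and> (\<forall>x\<in>{0..1}. u x \<ge> 0)
      \<and> (\<exists>x\<in>{0..1}. u x \<noteq> 0)"

text \<open>Isometric embedding of C([0,1]) (sup norm) into the bounded continuous functions on the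
  real line: extend u constantly outside [0,1].\<close>
definition emb01 :: "(real \<Rightarrow> real) \<Rightarrow> (real \<Rightarrow>\<^sub>C real)" where
  "emb01 u = Bcontfun (\<lambda>x. u (max 0 (min 1 x)))"

definition S_sym :: "real \<Rightarrow> real \<Rightarrow> (real \<times> (real \<Rightarrow>\<^sub>C real)) set" where
  "S_sym p h = {(lam, emb01 u) | lam u. sym_pos_sol p h lam u}"

definition S_nn :: "real \<Rightarrow> real \<Rightarrow> (real \<times> (real \<Rightarrow>\<^sub>C real)) set" where
  "S_nn p h = {(lam, emb01 u) | lam u. nonneg_nontriv_sol p h lam u}"

definition C_hs :: "real \<Rightarrow> real \<Rightarrow> (real \<times> (real \<Rightarrow>\<^sub>C real)) set" where
  "C_hs p h = connected_component_set (closure (S_sym p h)) (pi\<^sup>2, 0)"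

definition C_h :: "real \<Rightarrow> real \<Rightarrow> (real \<times> (real \<Rightarrow>\<^sub>C real)) set" where
  "C_h p h = connected_component_set (closure (S_nn p h)) (pi\<^sup>2, 0)"

definition U :: "real \<Rightarrow> real \<Rightarrow> real \<Rightarrow> (real \<Rightarrow>\<^sub>C real)" where
  "U p h lam = (THE f. \<exists>u. sym_pos_sol p h lam u \<and> f = emb01 u)"

definition Uext :: "real \<Rightarrow> real \<Rightarrow> real \<Rightarrow> (real \<Rightarrow>\<^sub>C real)" where
  "Uext p h lam = (if lam = pi\<^sup>2 then 0 else U p h lam)"

end

theory Submission
  imports Defs "HOL-Complex_Analysis.Great_Picard" "HOL-Real_Asymp.Real_Asymp"
begin

text \<open>By symmetry the problem lives on \<open>[0, 1/2]\<close>: with \<open>\<alpha> = (1 - h)/2\<close> the equation is autonomous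
  on \<open>[0, \<alpha>]\<close> and linear on \<open>[\<alpha>, 1/2]\<close>, where \<open>u' (1/2) = 0\<close> forces all solutions to share the same
  ratio \<open>u' \<alpha> / u \<alpha>\<close>. If \<open>u \<alpha> < v \<alpha>\<close> for two positive solutions, then \<open>v\<close> has the larger energy on
  \<open>[0, \<alpha>]\<close>, so \<open>\<bar>v'\<bar> > \<bar>u'\<bar>\<close> at every crossing; a first and a last crossing would produce a local
  minimum of \<open>v\<close> at positive energy, which is impossible. Hence \<open>u < v\<close> on \<open>(0, \<alpha>]\<close>, contradicting
  \<open>(u' v - u v')' = u v\<^sup>p - u\<^sup>p v > 0\<close> since the Wronskian vanishes at both ends. This gives
  uniqueness.

  Testing the equation with \<open>sin (pi x)\<close> yields \<open>0 < pi\<^sup>2 - \<lambda> \<le> \<parallel>u\<parallel>\<^bsup>p-1\<^esup>\<close>, so the only limit of positive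
  symmetric solutions that is not itself one is \<open>(pi\<^sup>2, 0)\<close>. The component is therefore a connected
  graph over \<open>(-\<infinity>, pi\<^sup>2]\<close> whose bounded parts are compact by Arzela-Ascoli. Such a graph cannot blow up
  at a finite \<open>\<lambda>\<close> (the part above a level that is skipped near \<open>\<lambda>\<close> would be open and closed), so it is
  continuous without any a priori estimate.\<close>

hide_const (open) Polynomial.content

section \<open>Absolutely continuous functions and the Henstock--Kurzweil integral\<close>

text \<open>Absolute continuity speaks of indexed families of intervals, whereas a tagged division
  supplies a finite set of nonoverlapping ones. The enumeration \<open>q\<close> bridges the two,
  and disjointness of interiors becomes the required order of endpoints.\<close>

lemma abs_cont_on_intervals:
  assumes d: "\<forall>(n::nat) (a::nat \<Rightarrow> real) (b::nat \<Rightarrow> real).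
        (\<forall>i<n. c \<le> a i \<and> a i \<le> b i \<and> b i \<le> d) \<longrightarrow>
        (\<forall>i<n. \<forall>j<n. i \<noteq> j \<longrightarrow> b i \<le> a j \<or> b j \<le> a i) \<longrightarrow>
        (\<Sum>i<n. b i - a i) < \<delta> \<longrightarrow>
        (\<Sum>i<n. \<bar>f (b i) - f (a i)\<bar>) < \<epsilon>"
    and K: "finite \<K>" "\<And>K. K \<in> \<K> \<Longrightarrow> \<exists>s t. s < t \<and> K = {s..t}" "\<And>K. K \<in> \<K> \<Longrightarrow> K \<subseteq> {c..d}"
    and disj: "\<And>K L. K \<in> \<K> \<Longrightarrow> L \<in> \<K> \<Longrightarrow> K \<noteq> L \<Longrightarrow> interior K \<inter> interior L = {}"
    and le: "(\<Sum>K\<in>\<K>. content K) < \<delta>"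
  shows "(\<Sum>K\<in>\<K>. \<bar>f (Sup K) - f (Inf K)\<bar>) < (\<epsilon>::real)"
proof -
  obtain q where q: "bij_betw q {0..<card \<K>} \<K>"
    using ex_bij_betw_nat_finite[OF K(1)] by blast
  define n where "n = card \<K>"
  have q: "bij_betw q {..<n} \<K>" using q by (simp add: n_def atLeast0LessThan)
  have qK: "q i \<in> \<K>" if "i < n" for i using q that by (auto simp: bij_betw_def)
  have st: "Inf (q i) < Sup (q i) \<and> q i = {Inf (q i)..Sup (q i)}" if "i < n" for i
    using K(2)[OF qK[OF that]] by force
  have "(\<Sum>i<n. \<bar>f (Sup (q i)) - f (Inf (q i))\<bar>) < \<epsilon>"
  proof (rule d[rule_format, of n "\<lambda>i. Inf (q i)" "\<lambda>i. Sup (q i)"])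
    show "c \<le> Inf (q i) \<and> Inf (q i) \<le> Sup (q i) \<and> Sup (q i) \<le> d" if "i < n" for i
    proof -
      have "Inf (q i) \<in> q i" "Sup (q i) \<in> q i"
        using st[OF that] by (metis atLeastAtMost_iff less_imp_le order_refl)+
      then show ?thesis using K(3)[OF qK[OF that]] st[OF that] by auto
    qed
    show "Sup (q i) \<le> Inf (q j) \<or> Sup (q j) \<le> Inf (q i)" if "i < n" "j < n" "i \<noteq> j" for i j
    proof (rule ccontr)
      assume "\<not> ?thesis"
      then have *: "Inf (q j) < Sup (q i)" "Inf (q i) < Sup (q j)" by auto
      have "q i \<noteq> q j" using q that by (auto simp: bij_betw_def inj_on_def)
      then have "interior (q i) \<inter> interior (q j) = {}" using disj qK that by auto
      then have "{Inf (q i)<..<Sup (q i)} \<inter> {Inf (q j)<..<Sup (q j)} = {}"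
        by (metis interior_atLeastAtMost_real st that(1,2))
      \<comment> \<open>If neither interval preceded the other, the midpoint of their overlap would
        lie in both interiors.\<close>
      moreover have "(max (Inf (q i)) (Inf (q j)) + min (Sup (q i)) (Sup (q j))) / 2
          \<in> {Inf (q i)<..<Sup (q i)} \<inter> {Inf (q j)<..<Sup (q j)}"
        using * st[OF that(1)] st[OF that(2)] by (auto simp: max_def min_def field_simps)
      ultimately show False by blast
    qed
    have "(\<Sum>i<n. Sup (q i) - Inf (q i)) = (\<Sum>i<n. content (q i))"
    proof (rule sum.cong)
      show "Sup (q i) - Inf (q i) = content (q i)" if "i \<in> {..<n}" for i
        using st[of i] that by (metis content_real lessThan_iff less_imp_le)
    qed simp
    also have "\<dots> = (\<Sum>K\<in>\<K>. content K)"
      using sum.reindex_bij_betw[OF q] by blast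
    finally show "(\<Sum>i<n. Sup (q i) - Inf (q i)) < \<delta>" using le by simp
  qed
  then show ?thesis using sum.reindex_bij_betw[OF q, of "\<lambda>K. \<bar>f (Sup K) - f (Inf K)\<bar>"] by simp
qed

text \<open>The gauge treats two kinds of tags differently. At a tag off \<open>N\<close>,
  differentiability makes the Riemann term match the increment of \<open>g\<close>. Intervals tagged
  in \<open>N\<close> are squeezed into an open set of small measure, where absolute continuity
  makes the total increment small.\<close>

lemma abs_cont_has_integral:
  fixes g f :: "real \<Rightarrow> real"
  assumes ac: "abs_cont_on a b g" and "a \<le> b" and N: "negligible N"
    and der: "\<And>x. x \<in> {a..b} - N \<Longrightarrow> (g has_real_derivative f x) (at x within {a..b})"
  shows "(f has_integral (g b - g a)) {a..b}"
proof -
  \<comment> \<open>With the value 0 on \<open>N\<close>, a tag there contributes only the increment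
    of \<open>g\<close>; the change on a null set is undone by the spike rule at the end.\<close>
  define F where "F x = (if x \<in> N then 0 else f x)" for x
  have "(F has_integral (g b - g a)) {a..b}"
    unfolding has_integral_real
  proof (intro allI impI)
    fix e :: real assume "e > 0"
    obtain \<delta> where "\<delta> > 0" and \<delta>: "\<forall>(n::nat) (s::nat \<Rightarrow> real) (t::nat \<Rightarrow> real).
        (\<forall>i<n. a \<le> s i \<and> s i \<le> t i \<and> t i \<le> b) \<longrightarrow>
        (\<forall>i<n. \<forall>j<n. i \<noteq> j \<longrightarrow> t i \<le> s j \<or> t j \<le> s i) \<longrightarrow>
        (\<Sum>i<n. t i - s i) < \<delta> \<longrightarrow>
        (\<Sum>i<n. \<bar>g (t i) - g (s i)\<bar>) < e/2"
      using ac[unfolded abs_cont_on_def, THEN spec, THEN mp, OF half_gt_zero[OF \<open>e > 0\<close>]]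
      by (elim exE conjE) (rule that)
    obtain T where T: "open T" "N \<subseteq> T" "T - N \<in> lmeasurable" "emeasure lebesgue (T - N) < ennreal \<delta>"
      using sets_lebesgue_outer_open[of N \<delta>] \<open>\<delta> > 0\<close> N by (auto simp: negligible_iff_null_sets)
    have Tm: "T \<in> lmeasurable"
    proof -
      have "N \<in> lmeasurable" using N by (simp add: negligible_imp_measurable)
      then have "(T - N) \<union> N \<in> lmeasurable" using T(3) by blast
      then show ?thesis using T(2) by (simp add: Un_absorb2)
    qed
    have mT: "measure lebesgue T < \<delta>"
    proof -
      have "measure lebesgue (T - N) < \<delta>"
        using T(3,4) \<open>\<delta> > 0\<close> by (simp add: emeasure_eq_measure2 ennreal_less_iff)
      moreover have "measure lebesgue (T - N) = measure lebesgue T"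
        using N T(1) by (intro measure_Diff_null_set) (auto simp: negligible_iff_null_sets borel_open)
      ultimately show ?thesis by simp
    qed
    \<comment> \<open>An error of \<open>e'\<close> per unit length costs at most \<open>e/2\<close>
      over the whole interval; the summand 1 keeps the denominator positive when
      \<open>a = b\<close>.\<close>
    define e' where "e' = e / (2 * (b - a + 1))"
    have e': "e' > 0" using \<open>e>0\<close> \<open>a \<le> b\<close> by (simp add: e'_def)
    have "\<exists>d>0. \<forall>y\<in>{a..b}. \<bar>y - x\<bar> < d \<longrightarrow> \<bar>g y - g x - f x * (y - x)\<bar> \<le> e' * \<bar>y - x\<bar>"
      if "x \<in> {a..b} - N" for x
    proof -
      have "(g has_derivative (\<lambda>h. f x * h)) (at x within {a..b})"
        using der[OF that] by (simp add: has_field_derivative_def)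
      then show ?thesis unfolding has_derivative_within_alt using e' by auto
    qed
    then obtain d where d: "\<And>x. x \<in> {a..b} - N \<Longrightarrow> d x > 0"
      "\<And>x y. x \<in> {a..b} - N \<Longrightarrow> y \<in> {a..b} \<Longrightarrow> \<bar>y - x\<bar> < d x \<Longrightarrow> \<bar>g y - g x - f x * (y - x)\<bar> \<le> e' * \<bar>y - x\<bar>"
      by metis
    define \<gamma> where "\<gamma> x = (if x \<in> N then T else if x \<in> {a..b} then ball x (d x) else ball x 1)" for x
    have "gauge \<gamma>"
      using d(1) T by (auto simp: gauge_def \<gamma>_def)
    moreover have "norm ((\<Sum>(x,K)\<in>\<D>. content K *\<^sub>R F x) - (g b - g a)) < e"
      if D: "\<D> tagged_division_of {a..b}" and fine: "\<gamma> fine \<D>" for \<D>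
    proof -
      have fin: "finite \<D>" using D by blast
      have props: "\<exists>s t. s \<le> t \<and> K = {s..t} \<and> x \<in> K \<and> K \<subseteq> {a..b} \<and> K \<subseteq> \<gamma> x" if xK: "(x,K) \<in> \<D>" for x K
      proof -
        obtain s t where st: "K = cbox s t" using tagged_division_ofD(4)[OF D xK] by blast
        have "x \<in> K" using tagged_division_ofD(2)[OF D that] .
        with st have "s \<le> t" by auto
        then show ?thesis using st \<open>x \<in> K\<close> tagged_division_ofD(3)[OF D that] fineD[OF fine that]
          by (auto simp: box_real)
      qed
      define G where "G = (\<lambda>(x::real,K). content K * F x - (g (Sup K) - g (Inf K)))"
      have tot: "(\<Sum>(x,K)\<in>\<D>. content K *\<^sub>R F x) - (g b - g a) = sum G \<D>"
        using additive_tagged_division_1[OF \<open>a \<le> b\<close> D, of g]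
        by (simp add: G_def case_prod_unfold sum_subtractf)
      define \<D>1 where "\<D>1 = {p\<in>\<D>. fst p \<notin> N}"
      define \<D>2 where "\<D>2 = {p\<in>\<D>. fst p \<in> N \<and> content (snd p) \<noteq> 0}"
      \<comment> \<open>Degenerate intervals contribute nothing. Removing them leaves intervals with
        nonempty interior in \<open>\<D>2\<close>, which are therefore pairwise distinct and meet
        the hypotheses of \<open>abs_cont_on_intervals\<close>.\<close>
      define \<D>3 where "\<D>3 = {p\<in>\<D>. fst p \<in> N \<and> content (snd p) = 0}"
      have split: "sum G \<D> = sum G \<D>1 + sum G \<D>2 + sum G \<D>3"
      proof -
        have "\<D> = (\<D>1 \<union> \<D>2) \<union> \<D>3" by (auto simp: \<D>1_def \<D>2_def \<D>3_def)
        moreover have "sum G ((\<D>1 \<union> \<D>2) \<union> \<D>3) = sum G (\<D>1 \<union> \<D>2) + sum G \<D>3"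
          by (rule sum.union_disjoint) (auto simp: \<D>1_def \<D>2_def \<D>3_def fin)
        moreover have "sum G (\<D>1 \<union> \<D>2) = sum G \<D>1 + sum G \<D>2"
          by (rule sum.union_disjoint) (auto simp: \<D>1_def \<D>2_def \<D>3_def fin)
        ultimately show ?thesis by simp
      qed
      have "sum G \<D>3 = 0"
      proof (rule sum.neutral, safe)
        fix x K assume "(x, K) \<in> \<D>3"
        then have "(x,K) \<in> \<D>" "content K = 0" by (auto simp: \<D>3_def)
        then show "G (x, K) = 0" using props[of x K] by (auto simp: G_def)
      qed
      moreover have "\<bar>sum G \<D>1\<bar> \<le> e' * (b - a)"
      proof -
        have "\<bar>sum G \<D>1\<bar> \<le> (\<Sum>p\<in>\<D>1. \<bar>G p\<bar>)" by (rule sum_abs)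
        also have "\<dots> \<le> (\<Sum>p\<in>\<D>1. e' * content (snd p))"
        proof (rule sum_mono, safe)
          fix x K assume "(x, K) \<in> \<D>1"
          then have xK: "(x,K) \<in> \<D>" "x \<notin> N" by (auto simp: \<D>1_def)
          then obtain s t where st: "s \<le> t" "K = {s..t}" "x \<in> K" "K \<subseteq> {a..b}" "K \<subseteq> \<gamma> x"
            using props by blast
          have x: "x \<in> {a..b} - N" using st xK by auto
          have "{s..t} \<subseteq> ball x (d x)" using st x by (auto simp: \<gamma>_def)
          then have "s \<in> ball x (d x)" "t \<in> ball x (d x)" using st(1) by auto
          then have "\<bar>g s - g x - f x * (s - x)\<bar> \<le> e' * \<bar>s - x\<bar>" "\<bar>g t - g x - f x * (t - x)\<bar> \<le> e' * \<bar>t - x\<bar>"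
            using d(2)[OF x, of s] d(2)[OF x, of t] st(1,2,4) by (auto simp: dist_real_def abs_minus_commute)
          \<comment> \<open>Straddling: the tag lies between the endpoints, so the errors at the two
            ends add up to \<open>e'\<close> times the length.\<close>
          moreover have "e' * \<bar>s - x\<bar> + e' * \<bar>t - x\<bar> = e' * (t - s)" using st by (auto simp: algebra_simps)
          moreover have "G (x,K) = (g s - g x - f x * (s - x)) - (g t - g x - f x * (t - x))"
            using st xK by (simp add: G_def F_def algebra_simps)
          ultimately show "\<bar>G (x,K)\<bar> \<le> e' * content (snd (x,K))" using st by simp
        qed
        also have "\<dots> \<le> (\<Sum>p\<in>\<D>. e' * content (snd p))"
          by (rule sum_mono2) (use fin e' in \<open>auto simp: \<D>1_def\<close>)
        also have "\<dots> = e' * (b - a)"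
          using additive_content_tagged_division[of \<D> a b] D \<open>a \<le> b\<close>
          by (simp add: sum_distrib_left[symmetric] case_prod_unfold)
        finally show ?thesis .
      qed
      moreover have "\<bar>sum G \<D>2\<bar> < e/2"
      proof -
        have nd: "\<exists>s t. s < t \<and> K = {s..t} \<and> K \<subseteq> {a..b} \<and> K \<subseteq> T" if "(x,K) \<in> \<D>2" for x K
          using props[of x K] that by (force simp: \<D>2_def \<gamma>_def)
        have disj: "interior K \<inter> interior L = {}" if "(x,K) \<in> \<D>2" "(y,L) \<in> \<D>2" "(x,K) \<noteq> (y,L)" for x K y L
          using tagged_division_ofD(5)[OF D, of x K y L] that by (simp add: \<D>2_def)
        have inj: "inj_on snd \<D>2"
        proof (rule inj_onI, rule ccontr)
          fix p q assume *: "p \<in> \<D>2" "q \<in> \<D>2" "snd p = snd q" "p \<noteq> q"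
          obtain s t where "s < t" "snd p = {s..t}"
            using nd[of "fst p" "snd p"] *(1) unfolding prod.collapse by blast
          moreover have "interior (snd p) \<inter> interior (snd q) = {}"
            using disj[of "fst p" "snd p" "fst q" "snd q"] *(1,2,4) unfolding prod.collapse by blast
          ultimately show False using *(3) by auto
        qed
        define \<K> where "\<K> = snd ` \<D>2"
        have finK: "finite \<K>" using fin by (simp add: \<K>_def \<D>2_def)
        have disjK: "interior K \<inter> interior L = {}" if "K \<in> \<K>" "L \<in> \<K>" "K \<noteq> L" for K L
        proof -
          obtain x y where "(x,K) \<in> \<D>2" "(y,L) \<in> \<D>2" using \<open>K \<in> \<K>\<close> \<open>L \<in> \<K>\<close> by (auto simp: \<K>_def)
          then show ?thesis using disj \<open>K \<noteq> L\<close> by blast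
        qed
        have int: "interior K \<in> lmeasurable \<and> measure lebesgue (interior K) = content K \<and> interior K \<subseteq> T"
          if "K \<in> \<K>" for K
        proof -
          obtain s t where "s < t" "K = {s..t}" "K \<subseteq> T" using nd \<open>K \<in> \<K>\<close> by (force simp: \<K>_def)
          then show ?thesis using interior_subset[of K] by auto
        qed
        \<comment> \<open>The interiors are disjoint as sets, so their measures add up to that of a
          subset of \<open>T\<close>; passing to interiors does not change lengths.\<close>
        have "(\<Sum>K\<in>\<K>. content K) = (\<Sum>K\<in>\<K>. measure lebesgue (interior K))"
          using int by simp
        also have "\<dots> = measure lebesgue (\<Union>K\<in>\<K>. interior K)"
        proof (rule measure_finite_Union[symmetric, OF finK])
          show "interior ` \<K> \<subseteq> sets lebesgue" using int by blast
          show "disjoint_family_on interior \<K>" using disjK by (auto simp: disjoint_family_on_def)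
          show "emeasure lebesgue (interior K) \<noteq> \<infinity>" if "K \<in> \<K>" for K
            using int[OF that] by (auto simp: fmeasurable_def)
        qed
        also have "\<dots> \<le> measure lebesgue T"
        proof (rule measure_mono_fmeasurable)
          show "(\<Union>K\<in>\<K>. interior K) \<subseteq> T" using int by blast
          show "(\<Union>K\<in>\<K>. interior K) \<in> sets lebesgue" using int finK by (intro sets.finite_UN) auto
        qed (fact Tm)
        also have "\<dots> < \<delta>" by (fact mT)
        finally have lt: "(\<Sum>K\<in>\<K>. content K) < \<delta>" .
        have *: "(\<Sum>K\<in>\<K>. \<bar>g (Sup K) - g (Inf K)\<bar>) < e/2"
        proof (rule abs_cont_on_intervals[OF \<delta>])
          show "\<exists>s t. s < t \<and> K = {s..t}" "K \<subseteq> {a..b}" if "K \<in> \<K>" for K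
            using nd that by (force simp: \<K>_def)+
        qed (use finK disjK lt in \<open>auto simp only:\<close>)
        have "\<bar>sum G \<D>2\<bar> \<le> (\<Sum>p\<in>\<D>2. \<bar>G p\<bar>)" by (rule sum_abs)
        also have "\<dots> = (\<Sum>p\<in>\<D>2. \<bar>g (Sup (snd p)) - g (Inf (snd p))\<bar>)"
          by (rule sum.cong) (auto simp: G_def F_def \<D>2_def)
        also have "\<dots> = (\<Sum>K\<in>\<K>. \<bar>g (Sup K) - g (Inf K)\<bar>)"
          unfolding \<K>_def by (subst sum.reindex[OF inj]) simp
        finally show ?thesis using * by simp
      qed
      moreover have "e' * (b - a) \<le> e/2"
        using \<open>a \<le> b\<close> \<open>e > 0\<close> by (simp add: e'_def field_simps)
      ultimately show ?thesis unfolding tot split by simp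
    qed
    ultimately show "\<exists>\<gamma>. gauge \<gamma> \<and> (\<forall>\<D>. \<D> tagged_division_of {a..b} \<and> \<gamma> fine \<D> \<longrightarrow>
        norm ((\<Sum>(x,K)\<in>\<D>. content K *\<^sub>R F x) - (g b - g a)) < e)"
      by (intro exI[of _ \<gamma>] conjI allI impI) auto
  qed
  then show ?thesis
    by (rule has_integral_spike[OF N, rotated]) (auto simp: F_def)
qed

section \<open>Elementary facts on derivatives\<close>

lemma within_mean_value:
  fixes f f' :: "real \<Rightarrow> real"
  assumes "a < b" and "\<And>x. x \<in> {a..b} \<Longrightarrow> (f has_real_derivative f' x) (at x within {a..b})"
  obtains z where "a < z" "z < b" "f b - f a = f' z * (b - a)"
  using mvt_simple[of a b f "\<lambda>x. (*) (f' x)"] assms by (auto simp: has_field_derivative_def)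

lemma within_deriv_nonneg_imp_le:
  fixes f f' :: "real \<Rightarrow> real"
  assumes "a \<le> b" and "\<And>x. x \<in> {a..b} \<Longrightarrow> (f has_real_derivative f' x) (at x within {a..b})"
    and "\<And>x. a < x \<Longrightarrow> x < b \<Longrightarrow> 0 \<le> f' x"
  shows "f a \<le> f b"
proof (cases "a < b")
  case True
  then obtain z where "a < z" "z < b" "f b - f a = f' z * (b - a)"
    using within_mean_value[of a b f f'] assms(2) by blast
  then show ?thesis using assms(3)[of z] True by (metis diff_ge_0_iff_ge less_imp_le mult_nonneg_nonneg)
qed (use assms(1) in simp)

lemma within_deriv_pos_imp_less:
  fixes f f' :: "real \<Rightarrow> real"
  assumes "a < b" and "\<And>x. x \<in> {a..b} \<Longrightarrow> (f has_real_derivative f' x) (at x within {a..b})"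
    and "\<And>x. a < x \<Longrightarrow> x < b \<Longrightarrow> 0 < f' x"
  shows "f a < f b"
proof -
  obtain z where "a < z" "z < b" "f b - f a = f' z * (b - a)"
    using within_mean_value[of a b f f'] assms(1,2) by blast
  then show ?thesis using assms(3)[of z] assms(1) by (metis diff_gt_0_iff_gt mult_pos_pos)
qed

text \<open>Gronwall's argument for \<open>\<phi> = w^2 + w'^2\<close>: since
  \<open>2 |w| |w'| \<le> \<phi>\<close>, the derivative of \<open>\<phi>\<close> is at most
  \<open>(1 + L) \<phi>\<close> in modulus. Hence \<open>\<phi>\<close> times a decaying or growing
  exponential is monotone away from \<open>x0\<close>, on either side. An inequality for
  \<open>w''\<close> instead of an equation lets the lemma serve differences of solutions of a
  nonlinear equation.\<close>

lemma second_order_zero: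
  fixes w w' w'' :: "real \<Rightarrow> real"
  assumes w: "\<And>x. x \<in> {a..b} \<Longrightarrow> (w has_real_derivative w' x) (at x within {a..b})"
    and w': "\<And>x. x \<in> {a..b} \<Longrightarrow> (w' has_real_derivative w'' x) (at x within {a..b})"
    and L: "\<And>x. x \<in> {a..b} \<Longrightarrow> \<bar>w'' x\<bar> \<le> L * \<bar>w x\<bar>" and L0: "L \<ge> 0"
    and x0: "x0 \<in> {a..b}" "w x0 = 0" "w' x0 = 0"
    and x: "x \<in> {a..b}"
  shows "w x = 0 \<and> w' x = 0"
proof -
  define \<phi> where "\<phi> x = (w x)\<^sup>2 + (w' x)\<^sup>2" for x
  define \<phi>' where "\<phi>' x = 2 * w x * w' x + 2 * w' x * w'' x" for x
  define C where "C = 1 + L"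
  have d\<phi>: "(\<phi> has_real_derivative \<phi>' x) (at x within {a..b})" if "x \<in> {a..b}" for x
    unfolding \<phi>_def \<phi>'_def by (auto intro!: derivative_eq_intros w w' that)
  have bound: "\<bar>\<phi>' x\<bar> \<le> C * \<phi> x" if "x \<in> {a..b}" for x
  proof -
    have "\<bar>2 * w' x * w'' x\<bar> \<le> 2 * \<bar>w' x\<bar> * (L * \<bar>w x\<bar>)"
      using L[OF that] by (simp add: abs_mult mult_left_mono)
    moreover have "\<bar>2 * w x * w' x\<bar> = 2 * \<bar>w x\<bar> * \<bar>w' x\<bar>" by (simp add: abs_mult)
    ultimately have "\<bar>\<phi>' x\<bar> \<le> C * (2 * \<bar>w x\<bar> * \<bar>w' x\<bar>)"
      using abs_triangle_ineq[of "2 * w x * w' x" "2 * w' x * w'' x"]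
      unfolding \<phi>'_def C_def by (simp add: algebra_simps)
    also have "\<dots> \<le> C * \<phi> x"
      using sum_squares_bound[of "\<bar>w x\<bar>" "\<bar>w' x\<bar>"] L0 by (intro mult_left_mono) (auto simp: C_def \<phi>_def)
    finally show ?thesis .
  qed
  have "\<phi> x \<le> 0"
  proof (cases "x0 \<le> x")
    case True
    have "- (\<phi> x0 * exp (- C * x0)) \<le> - (\<phi> x * exp (- C * x))"
    proof (rule within_deriv_nonneg_imp_le[OF True])
      show "((\<lambda>x. - (\<phi> x * exp (- C * x))) has_real_derivative (C * \<phi> y - \<phi>' y) * exp (- C * y)) (at y within {x0..x})"
        if "y \<in> {x0..x}" for y
      proof -
        have "(\<phi> has_real_derivative \<phi>' y) (at y within {x0..x})"
          by (rule DERIV_subset[OF d\<phi>]) (use that x x0 in auto)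
        then show ?thesis by (auto intro!: derivative_eq_intros simp: algebra_simps)
      qed
      show "0 \<le> (C * \<phi> y - \<phi>' y) * exp (- C * y)" if "x0 < y" "y < x" for y
        using bound[of y] that x x0 by auto
    qed
    then show ?thesis using x0 by (simp add: \<phi>_def mult_le_0_iff)
  next
    case False
    then have "x \<le> x0" by simp
    then have "\<phi> x * exp (C * x) \<le> \<phi> x0 * exp (C * x0)"
    proof (rule within_deriv_nonneg_imp_le)
      show "((\<lambda>x. \<phi> x * exp (C * x)) has_real_derivative (C * \<phi> y + \<phi>' y) * exp (C * y)) (at y within {x..x0})"
        if "y \<in> {x..x0}" for y
      proof -
        have "(\<phi> has_real_derivative \<phi>' y) (at y within {x..x0})"
          by (rule DERIV_subset[OF d\<phi>]) (use that x x0 in auto)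
        then show ?thesis by (auto intro!: derivative_eq_intros simp: algebra_simps)
      qed
      show "0 \<le> (C * \<phi> y + \<phi>' y) * exp (C * y)" if "x < y" "y < x0" for y
        using bound[of y] that x x0 by auto
    qed
    then show ?thesis using x0 by (simp add: \<phi>_def mult_le_0_iff)
  qed
  then show ?thesis unfolding \<phi>_def by (simp add: sum_power2_le_zero_iff)
qed

text \<open>The mean value theorem needs the derivative only strictly between \<open>s\<close> and
  \<open>t\<close>, so the value 0 is allowed as an endpoint; \<open>p > 1\<close> keeps the
  derivative bounded near it.\<close>

lemma powr_Lipschitz:
  fixes p :: real
  assumes "p > 1" "0 \<le> s" "s \<le> M" "0 \<le> t" "t \<le> M"
  shows "\<bar>s powr p - t powr p\<bar> \<le> p * M powr (p - 1) * \<bar>s - t\<bar>"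
proof -
  have *: "\<bar>t powr p - s powr p\<bar> \<le> p * M powr (p - 1) * \<bar>t - s\<bar>"
    if "0 \<le> s" "s < t" "t \<le> M" for s t
  proof -
    have "continuous_on {s..t} (\<lambda>x. x powr p)"
      using that assms(1) by (intro continuous_on_powr' continuous_intros) auto
    moreover have "((\<lambda>x. x powr p) has_derivative (*) (p * x powr (p - 1))) (at x)" if "s < x" for x
      using has_real_derivative_powr[of x p] that \<open>0 \<le> s\<close> by (simp add: has_field_derivative_def)
    ultimately obtain z where z: "s < z" "z < t" "t powr p - s powr p = p * z powr (p - 1) * (t - s)"
      using mvt[OF \<open>s < t\<close>, of "\<lambda>x. x powr p" "\<lambda>x. (*) (p * x powr (p - 1))"] by auto
    have "z powr (p - 1) \<le> M powr (p - 1)"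
      using z that assms(1) by (intro powr_mono2) auto
    then have "p * z powr (p - 1) * (t - s) \<le> p * M powr (p - 1) * (t - s)"
      using assms(1) that by (intro mult_right_mono mult_left_mono) auto
    then show ?thesis using z(3) that assms(1) z(1) by (simp add: abs_mult)
  qed
  show ?thesis using *[of s t] *[of t s] assms by (cases s t rule: linorder_cases) (auto simp: abs_minus_commute)
qed

text \<open>The point is the supremum of the closed set where \<open>f \<le> 0\<close>; a negative
  value there would give a later zero by the intermediate value theorem. This locates last crossings
  and last critical points in the comparison of two solutions.\<close>

lemma last_zero:
  fixes f :: "real \<Rightarrow> real"
  assumes "continuous_on {a..b} f" "a \<le> b" "f a \<le> 0" "0 < f b"
  obtains z where "a \<le> z" "z < b" "f z = 0" "\<And>x. z < x \<Longrightarrow> x \<le> b \<Longrightarrow> 0 < f x"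
proof -
  define S where "S = {x\<in>{a..b}. f x \<le> 0}"
  have "closed S" unfolding S_def
    using continuous_on_closed_Collect_le[OF assms(1) continuous_on_const[of _ 0]] by simp
  moreover have "S \<subseteq> {a..b}" "a \<in> S" using assms by (auto simp: S_def)
  moreover from this have "bdd_above S" by (meson bdd_above_Icc bdd_above_mono)
  ultimately have "Sup S \<in> S" and up: "\<And>x. x \<in> S \<Longrightarrow> x \<le> Sup S"
    using closed_contains_Sup[of S] cSup_upper[of _ S] by auto
  define z where "z = Sup S"
  have z: "a \<le> z" "z \<le> b" "f z \<le> 0" using \<open>Sup S \<in> S\<close> by (auto simp: z_def S_def)
  then have "z < b" using assms(4) by (cases "z = b") auto
  have pos: "0 < f x" if "z < x" "x \<le> b" for x
    using up[of x] that z by (force simp: S_def z_def)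
  have "f z = 0"
  proof (rule ccontr)
    assume "f z \<noteq> 0"
    then have "f z < 0" using z by simp
    moreover have "continuous_on {z..b} f" by (rule continuous_on_subset[OF assms(1)]) (use z in auto)
    ultimately obtain y where y: "z \<le> y" "y \<le> b" "f y = 0"
      using IVT'[of f z 0 b] assms(4) \<open>z < b\<close> by auto
    then have "z < y" using \<open>f z < 0\<close> by (cases "y = z") auto
    then show False using pos[of y] y by simp
  qed
  then show ?thesis using that[of z] z \<open>z < b\<close> pos by blast
qed

lemma first_zero:
  fixes f :: "real \<Rightarrow> real"
  assumes "continuous_on {a..b} f" "a \<le> b" "0 < f a" "f b \<le> 0"
  obtains z where "a < z" "z \<le> b" "f z = 0" "\<And>x. a \<le> x \<Longrightarrow> x < z \<Longrightarrow> 0 < f x"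
proof -
  have "continuous_on {-b..-a} (\<lambda>x. f (-x))"
    by (rule continuous_on_compose2[OF assms(1)]) (auto intro!: continuous_intros)
  then obtain z where z: "-b \<le> z" "z < -a" "f (-z) = 0" "\<And>x. z < x \<Longrightarrow> x \<le> -a \<Longrightarrow> 0 < f (-x)"
    using last_zero[of "-b" "-a" "\<lambda>x. f (-x)"] assms(2-4) by auto
  have "0 < f x" if "a \<le> x" "x < -z" for x using z(4)[of "-x"] that by simp
  then show ?thesis using that[of "-z"] z by auto
qed

lemma deriv_nonneg_at_left_end:
  fixes f :: "real \<Rightarrow> real"
  assumes "(f has_real_derivative D) (at z within S)" "z < b" "{z..b} \<subseteq> S"
    and "\<And>x. z < x \<Longrightarrow> x \<le> b \<Longrightarrow> f z \<le> f x"
  shows "0 \<le> D"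
proof (rule ccontr)
  assume "\<not> 0 \<le> D"
  then obtain d where d: "d > 0" "\<And>h. h > 0 \<Longrightarrow> z + h \<in> S \<Longrightarrow> h < d \<Longrightarrow> f z > f (z + h)"
    using has_real_derivative_neg_dec_right[OF assms(1)] by auto
  define h where "h = min (d/2) (b - z)"
  have "h > 0" "h < d" "z + h \<le> b" using d(1) assms(2) by (auto simp: h_def)
  moreover from this have "z + h \<in> S" using assms(3) by auto
  ultimately show False using d(2)[of h] assms(4)[of "z + h"] by auto
qed

lemma deriv_nonpos_at_right_end:
  fixes f :: "real \<Rightarrow> real"
  assumes "(f has_real_derivative D) (at z within S)" "a < z" "{a..z} \<subseteq> S"
    and "\<And>x. a \<le> x \<Longrightarrow> x < z \<Longrightarrow> f z \<le> f x"
  shows "D \<le> 0"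
proof (rule ccontr)
  assume "\<not> D \<le> 0"
  then obtain d where d: "d > 0" "\<And>h. h > 0 \<Longrightarrow> z - h \<in> S \<Longrightarrow> h < d \<Longrightarrow> f (z - h) < f z"
    using has_real_derivative_pos_inc_left[OF assms(1)] by auto
  define h where "h = min (d/2) (z - a)"
  have "h > 0" "h < d" "a \<le> z - h" using d(1) assms(2) by (auto simp: h_def)
  moreover from this have "z - h \<in> S" using assms(3) by auto
  ultimately show False using d(2)[of h] assms(4)[of "z - h"] by auto
qed

section \<open>Symmetric positive solutions on the half interval\<close>

text \<open>Here \<open>\<alpha>\<close> is the interface where the coefficient jumps, so
  \<open>u''\<close> is prescribed one-sidedly on each closed piece. The Neumann condition at 1/2
  replaces symmetry. Only \<open>u \<ge> 0\<close> is required, which admits the zero function as a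
  competitor in uniqueness arguments.\<close>

definition half_sol :: "real \<Rightarrow> real \<Rightarrow> real \<Rightarrow> (real \<Rightarrow> real) \<Rightarrow> (real \<Rightarrow> real) \<Rightarrow> bool" where
  "half_sol p \<alpha> lam u u' \<longleftrightarrow>
     (\<forall>x\<in>{0..1/2}. (u has_real_derivative u' x) (at x within {0..1/2})) \<and>
     (\<forall>x\<in>{0..\<alpha>}. (u' has_real_derivative - (lam * u x + u x powr p)) (at x within {0..\<alpha>})) \<and>
     (\<forall>x\<in>{\<alpha>..1/2}. (u' has_real_derivative - (lam * u x)) (at x within {\<alpha>..1/2})) \<and>
     (\<forall>x\<in>{0..1/2}. 0 \<le> u x) \<and> u 0 = 0 \<and> u' (1/2) = 0"

context
  fixes p \<alpha> :: real
  assumes p: "p > 1" and \<alpha>: "0 < \<alpha>" "\<alpha> < 1/2"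
begin

section \<open>Cauchy uniqueness and strict positivity on the half interval\<close>

lemma half_sol_0: "half_sol p \<alpha> lam (\<lambda>_. 0) (\<lambda>_. 0)"
  using p by (auto simp: half_sol_def)

lemma half_solD:
  assumes "half_sol p \<alpha> lam u u'"
  shows "\<And>x. x \<in> {0..1/2} \<Longrightarrow> (u has_real_derivative u' x) (at x within {0..1/2})"
    and "\<And>x. x \<in> {0..\<alpha>} \<Longrightarrow> (u has_real_derivative u' x) (at x within {0..\<alpha>})"
    and "\<And>x. x \<in> {\<alpha>..1/2} \<Longrightarrow> (u has_real_derivative u' x) (at x within {\<alpha>..1/2})"
    and "\<And>x. x \<in> {0..\<alpha>} \<Longrightarrow> (u' has_real_derivative - (lam * u x + u x powr p)) (at x within {0..\<alpha>})"
    and "\<And>x. x \<in> {\<alpha>..1/2} \<Longrightarrow> (u' has_real_derivative - (lam * u x)) (at x within {\<alpha>..1/2})"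
    and "\<And>x. x \<in> {0..1/2} \<Longrightarrow> 0 \<le> u x" and "u 0 = 0" and "u' (1/2) = 0"
proof -
  show *: "(u has_real_derivative u' x) (at x within {0..1/2})" if "x \<in> {0..1/2}" for x
    using assms that by (auto simp: half_sol_def)
  show "(u has_real_derivative u' x) (at x within {0..\<alpha>})" if "x \<in> {0..\<alpha>}" for x
    by (rule DERIV_subset[OF *]) (use that \<alpha> in auto)
  show "(u has_real_derivative u' x) (at x within {\<alpha>..1/2})" if "x \<in> {\<alpha>..1/2}" for x
    by (rule DERIV_subset[OF *]) (use that \<alpha> in auto)
qed (use assms in \<open>auto simp: half_sol_def\<close>)

lemma half_sol_bdd:
  assumes "half_sol p \<alpha> lam u u'"
  obtains M where "\<And>x. x \<in> {0..1/2} \<Longrightarrow> u x \<le> M"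
proof -
  have "continuous_on {0..1/2} u"
    by (rule DERIV_continuous_on) (use half_solD(1)[OF assms] in blast)
  then have "bdd_above (u ` {0..1/2})"
    by (intro bounded_imp_bdd_above compact_imp_bounded compact_continuous_image) auto
  then obtain M where "\<forall>x\<in>{0..1/2}. u x \<le> M" by (auto simp: bdd_above_def)
  then show ?thesis using that by blast
qed

text \<open>The difference of two solutions satisfies the hypothesis of
  \<open>second_order_zero\<close> on each piece. Vanishing data at \<open>x0\<close> are carried
  first to the interface \<open>\<alpha>\<close> and from there to \<open>x\<close>, possibly into
  the other piece.\<close>

lemma half_sol_unique_ivp:
  assumes u: "half_sol p \<alpha> lam u u'" and v: "half_sol p \<alpha> lam v v'"
    and x0: "x0 \<in> {0..1/2}" "u x0 = v x0" "u' x0 = v' x0" and x: "x \<in> {0..1/2}"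
  shows "u x = v x \<and> u' x = v' x"
proof -
  obtain M1 M2 where M1: "\<And>x. x \<in> {0..1/2} \<Longrightarrow> u x \<le> M1" and M2: "\<And>x. x \<in> {0..1/2} \<Longrightarrow> v x \<le> M2"
    using half_sol_bdd u v by metis
  define M where "M = max M1 M2"
  have M: "u x \<le> M" "v x \<le> M" if "x \<in> {0..1/2}" for x
    using M1[OF that] M2[OF that] by (auto simp: M_def)
  define w where "w x = u x - v x" for x
  define w' where "w' x = u' x - v' x" for x
  \<comment> \<open>A Lipschitz constant of \<open>s \<mapsto> lam s + s^p\<close> on the common
    range of values of \<open>u\<close> and \<open>v\<close>.\<close>
  define L where "L = \<bar>lam\<bar> + p * M powr (p - 1)"
  have L: "L \<ge> 0" using p by (simp add: L_def)
  have left: "w y = 0 \<and> w' y = 0" if "z \<in> {0..\<alpha>}" "w z = 0" "w' z = 0" "y \<in> {0..\<alpha>}" for y z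
  proof (rule second_order_zero[of 0 \<alpha> w w' "\<lambda>x. - (lam * u x + u x powr p) - - (lam * v x + v x powr p)" L z])
    fix x assume x: "x \<in> {0..\<alpha>}"
    show "(w has_real_derivative w' x) (at x within {0..\<alpha>})"
      unfolding w_def w'_def by (rule DERIV_diff[OF half_solD(2)[OF u x] half_solD(2)[OF v x]])
    show "(w' has_real_derivative - (lam * u x + u x powr p) - - (lam * v x + v x powr p)) (at x within {0..\<alpha>})"
      unfolding w'_def by (rule DERIV_diff[OF half_solD(4)[OF u x] half_solD(4)[OF v x]])
    have xh: "x \<in> {0..1/2}" using x \<alpha> by auto
    have "\<bar>u x powr p - v x powr p\<bar> \<le> p * M powr (p - 1) * \<bar>u x - v x\<bar>"
      by (rule powr_Lipschitz[OF p]) (use M[OF xh] half_solD(6)[OF u xh] half_solD(6)[OF v xh] in auto)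
    moreover have "\<bar>- (lam * u x + u x powr p) - - (lam * v x + v x powr p)\<bar>
        \<le> \<bar>lam * (u x - v x)\<bar> + \<bar>u x powr p - v x powr p\<bar>"
      using abs_triangle_ineq[of "lam * (u x - v x)" "u x powr p - v x powr p"]
      by (simp add: algebra_simps)
    ultimately show "\<bar>- (lam * u x + u x powr p) - - (lam * v x + v x powr p)\<bar> \<le> L * \<bar>w x\<bar>"
      by (simp add: L_def w_def abs_mult distrib_right)
  qed (use that L in auto)
  have right: "w y = 0 \<and> w' y = 0" if "z \<in> {\<alpha>..1/2}" "w z = 0" "w' z = 0" "y \<in> {\<alpha>..1/2}" for y z
  proof (rule second_order_zero[of \<alpha> "1/2" w w' "\<lambda>x. - (lam * u x) - - (lam * v x)" "\<bar>lam\<bar>" z])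
    fix x assume x: "x \<in> {\<alpha>..1/2}"
    show "(w has_real_derivative w' x) (at x within {\<alpha>..1/2})"
      unfolding w_def w'_def by (rule DERIV_diff[OF half_solD(3)[OF u x] half_solD(3)[OF v x]])
    show "(w' has_real_derivative - (lam * u x) - - (lam * v x)) (at x within {\<alpha>..1/2})"
      unfolding w'_def by (rule DERIV_diff[OF half_solD(5)[OF u x] half_solD(5)[OF v x]])
    show "\<bar>- (lam * u x) - - (lam * v x)\<bar> \<le> \<bar>lam\<bar> * \<bar>w x\<bar>"
      by (simp add: w_def abs_mult[symmetric] algebra_simps abs_minus_commute)
  qed (use that in auto)
  have w0: "w x0 = 0" "w' x0 = 0" using x0 by (auto simp: w_def w'_def)
  have "w \<alpha> = 0 \<and> w' \<alpha> = 0"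
    using left[of x0 \<alpha>] right[of x0 \<alpha>] w0 x0(1) \<alpha> by (cases "x0 \<le> \<alpha>") auto
  then have "w x = 0 \<and> w' x = 0"
    using left[of \<alpha> x] right[of \<alpha> x] x \<alpha> by (cases "x \<le> \<alpha>") auto
  then show ?thesis by (simp add: w_def w'_def)
qed

text \<open>A zero inside the interval is a minimum, hence critical; at 1/2 the Neumann condition
  gives the same. The Cauchy data then agree with those of the zero solution.\<close>

lemma half_sol_eq_0:
  assumes u: "half_sol p \<alpha> lam u u'" and x0: "0 < x0" "x0 \<le> 1/2" "u x0 = 0" and x: "x \<in> {0..1/2}"
  shows "u x = 0"
proof -
  have "u' x0 = 0"
  proof (cases "x0 < 1/2")
    case True
    have x0h: "x0 \<in> {0..1/2}" using x0 by simp
    have "0 \<le> u' x0"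
      by (rule deriv_nonneg_at_left_end[OF half_solD(1)[OF u x0h], of "1/2"])
        (use x0 True half_solD(6)[OF u] in auto)
    moreover have "u' x0 \<le> 0"
      by (rule deriv_nonpos_at_right_end[OF half_solD(1)[OF u x0h], of 0])
        (use x0 True half_solD(6)[OF u] in auto)
    ultimately show ?thesis by simp
  next
    case False
    then have "x0 = 1/2" using x0 by simp
    then show ?thesis using half_solD(8)[OF u] by (simp only:)
  qed
  then show ?thesis using half_sol_unique_ivp[OF u half_sol_0, of x0 x] x0 x by auto
qed

section \<open>Initial slope and conserved energy on the nonlinear piece\<close>

lemma half_sol_slope_pos:
  assumes u: "half_sol p \<alpha> lam u u'" and pos: "\<And>x. 0 < x \<Longrightarrow> x \<le> 1/2 \<Longrightarrow> 0 < u x"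
  shows "0 < u' 0"
proof -
  have "0 \<le> u' 0"
    by (rule deriv_nonneg_at_left_end[OF half_solD(1)[OF u], of 0 "1/2"])
      (use half_solD(6,7)[OF u] in auto)
  moreover have "u' 0 \<noteq> 0"
    using half_sol_unique_ivp[OF u half_sol_0, of 0 "1/2"] pos[of "1/2"] half_solD(7)[OF u] by auto
  ultimately show ?thesis by simp
qed

text \<open>Multiplying the equation by \<open>2 u'\<close> shows that the derivative of the left
  side vanishes. Positivity is used to differentiate the power in the open interval; continuity
  extends the identity to both ends, and at 0 only the kinetic term survives.\<close>

lemma half_sol_energy:
  assumes u: "half_sol p \<alpha> lam u u'" and pos: "\<And>x. 0 < x \<Longrightarrow> x \<le> 1/2 \<Longrightarrow> 0 < u x"
    and x: "0 \<le> x" "x \<le> \<alpha>"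
  shows "(u' x)\<^sup>2 + lam * (u x)\<^sup>2 + 2 / (p + 1) * u x powr (p + 1) = (u' 0)\<^sup>2"
proof -
  define E where "E x = (u' x)\<^sup>2 + lam * (u x)\<^sup>2 + 2 / (p + 1) * u x powr (p + 1)" for x
  have "E x = E 0"
  proof (rule DERIV_isconst2[of 0 \<alpha>])
    have "continuous_on {0..\<alpha>} u" "continuous_on {0..\<alpha>} u'"
      by (rule DERIV_continuous_on[OF half_solD(2)[OF u]], assumption)
        (rule DERIV_continuous_on[OF half_solD(4)[OF u]], assumption)
    then show "continuous_on {0..\<alpha>} E"
      unfolding E_def using p half_solD(6)[OF u] \<alpha>
      by (intro continuous_intros continuous_on_powr') auto
    fix y assume y: "0 < y" "y < \<alpha>"
    then have "(u has_real_derivative u' y) (at y)" "(u' has_real_derivative - (lam * u y + u y powr p)) (at y)"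
      using half_solD(2,4)[OF u, of y] at_within_Icc_at[of 0 y \<alpha>] by auto
    moreover have "0 < u y" using pos y \<alpha> by auto
    ultimately have du: "(u has_real_derivative u' y) (at y)"
      and du': "(u' has_real_derivative - (lam * u y + u y powr p)) (at y)"
      and dup: "((\<lambda>x. u x powr (p + 1)) has_real_derivative (p + 1) * u y powr p * u' y) (at y)"
      using DERIV_fun_powr[of u "u' y" y "p + 1"] by auto
    show "(E has_real_derivative 0) (at y)"
      unfolding E_def
      by (rule du du' dup refl derivative_eq_intros)+ (use p in \<open>simp add: field_simps\<close>)
  qed (use x \<alpha> in auto)
  then show ?thesis using half_solD(7)[OF u] by (simp add: E_def)
qed

text \<open>The energy \<open>u'(0)^2\<close> is positive, so at a critical point
  \<open>lam u + 2/(p+1) u^p > 0\<close>, and \<open>2/(p+1) \<le> 1\<close>. Thus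
  \<open>u'' < 0\<close> there, which rules out local minima on \<open>(0, \<alpha>]\<close>
  whatever the sign of \<open>lam\<close>.\<close>

lemma half_sol_concave_at_critical:
  assumes u: "half_sol p \<alpha> lam u u'" and pos: "\<And>x. 0 < x \<Longrightarrow> x \<le> 1/2 \<Longrightarrow> 0 < u x"
    and x: "0 < x" "x \<le> \<alpha>" "u' x = 0"
  shows "0 < lam * u x + u x powr p"
proof -
  have ux: "0 < u x" using pos x \<alpha> by auto
  have "0 < lam * (u x)\<^sup>2 + 2 / (p + 1) * u x powr (p + 1)"
    using half_sol_energy[OF u pos, of x] x half_sol_slope_pos[OF u pos] by (simp add: zero_less_power)
  also have "\<dots> = u x * (lam * u x + 2 / (p + 1) * u x powr p)"
    using ux by (simp add: powr_add power2_eq_square algebra_simps)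
  finally have "0 < lam * u x + 2 / (p + 1) * u x powr p" using ux by (simp add: zero_less_mult_iff)
  also have "\<dots> \<le> lam * u x + 1 * u x powr p"
    using p by (intro add_left_mono mult_right_mono) (auto simp: field_simps)
  finally show ?thesis by simp
qed

text \<open>On \<open>[\<alpha>, 1/2]\<close> both functions solve the same linear equation, so
  their Wronskian is constant, and it vanishes at 1/2 by the Neumann conditions.\<close>

lemma half_sol_robin:
  assumes u: "half_sol p \<alpha> lam u u'" and v: "half_sol p \<alpha> lam v v'"
  shows "u' \<alpha> * v \<alpha> = u \<alpha> * v' \<alpha>"
proof -
  define W where "W x = u' x * v x - u x * v' x" for x
  have "(W has_real_derivative 0) (at x within {\<alpha>..1/2})" if x: "x \<in> {\<alpha>..1/2}" for x
    unfolding W_def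
    by (rule DERIV_cong[OF DERIV_diff[OF DERIV_mult[OF half_solD(5)[OF u x] half_solD(3)[OF v x]]
        DERIV_mult[OF half_solD(3)[OF u x] half_solD(5)[OF v x]]]]) (simp add: algebra_simps)
  then obtain z where "W (1/2) - W \<alpha> = 0 * (1/2 - \<alpha>)"
    using within_mean_value[OF \<alpha>(2), of W "\<lambda>_. 0"] by blast
  then show ?thesis using half_solD(8)[OF u] half_solD(8)[OF v] by (simp add: W_def)
qed

text \<open>The Wronskian vanishes at 0 by the Dirichlet conditions and at \<open>\<alpha>\<close>
  by \<open>half_sol_robin\<close>. Its derivative is \<open>u v (v^(p-1) - u^(p-1))\<close>, which
  would be positive in between.\<close>

lemma half_sol_no_ordering:
  assumes u: "half_sol p \<alpha> lam u u'" and v: "half_sol p \<alpha> lam v v'"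
    and pos: "\<And>x. 0 < x \<Longrightarrow> x \<le> 1/2 \<Longrightarrow> 0 < u x"
    and less: "\<And>x. 0 < x \<Longrightarrow> x \<le> \<alpha> \<Longrightarrow> u x < v x"
  shows False
proof -
  define W where "W x = u' x * v x - u x * v' x" for x
  have "W 0 < W \<alpha>"
  proof (rule within_deriv_pos_imp_less[OF \<alpha>(1)])
    show "(W has_real_derivative u x * v x powr p - u x powr p * v x) (at x within {0..\<alpha>})"
      if x: "x \<in> {0..\<alpha>}" for x
      unfolding W_def
      by (rule DERIV_cong[OF DERIV_diff[OF DERIV_mult[OF half_solD(4)[OF u x] half_solD(2)[OF v x]]
        DERIV_mult[OF half_solD(2)[OF u x] half_solD(4)[OF v x]]]]) (simp add: algebra_simps)
    show "0 < u x * v x powr p - u x powr p * v x" if x: "0 < x" "x < \<alpha>" for x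
    proof -
      have ux: "0 < u x" "u x < v x" using pos less x \<alpha> by auto
      then have "u x powr (p - 1) < v x powr (p - 1)" using p by (intro powr_less_mono2) auto
      then have "u x * v x * u x powr (p - 1) < u x * v x * v x powr (p - 1)"
        using ux by (intro mult_strict_left_mono) auto
      moreover have "y powr p = y * y powr (p - 1)" if "y > 0" for y :: real
        using that powr_mult_base[of y "p - 1"] by simp
      ultimately show ?thesis using ux by (simp add: mult_ac)
    qed
  qed
  then show False using half_sol_robin[OF u v] half_solD(7)[OF u] half_solD(7)[OF v] by (simp add: W_def)
qed

text \<open>A larger value at \<open>\<alpha>\<close> forces a larger energy, because the slopes
  there are proportional to the values. With the larger energy \<open>v\<close> cannot cross
  \<open>u\<close> inside \<open>(0, \<alpha>]\<close> without having a critical point where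
  \<open>v'' \<ge> 0\<close>; without crossings the two are ordered, which is also
  impossible.\<close>

lemma half_sol_le_at_interface:
  assumes u: "half_sol p \<alpha> lam u u'" and v: "half_sol p \<alpha> lam v v'"
    and upos: "\<And>x. 0 < x \<Longrightarrow> x \<le> 1/2 \<Longrightarrow> 0 < u x"
    and vpos: "\<And>x. 0 < x \<Longrightarrow> x \<le> 1/2 \<Longrightarrow> 0 < v x"
  shows "v \<alpha> \<le> u \<alpha>"
proof (rule ccontr)
  assume "\<not> v \<alpha> \<le> u \<alpha>"
  then have lt: "u \<alpha> < v \<alpha>" by simp
  have ua: "0 < u \<alpha>" and va: "0 < v \<alpha>" using upos vpos \<alpha> by auto
  define k where "k = u' \<alpha> / u \<alpha>"
  have ku: "u' \<alpha> = k * u \<alpha>" using ua by (simp add: k_def)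
  have kv: "v' \<alpha> = k * v \<alpha>" using half_sol_robin[OF u v] ua by (simp add: k_def field_simps)
  \<comment> \<open>The energy at \<open>\<alpha>\<close> is \<open>y^2 G y\<close> with
    \<open>y\<close> the value there. Positivity of the energy makes \<open>G\<close> positive at
    \<open>u \<alpha>\<close>, so both factors increase strictly from \<open>u \<alpha>\<close> to
    \<open>v \<alpha>\<close>.\<close>
  define G where "G y = k\<^sup>2 + lam + 2 / (p + 1) * y powr (p - 1)" for y
  have E: "y\<^sup>2 * G y = (k * y)\<^sup>2 + lam * y\<^sup>2 + 2 / (p + 1) * y powr (p + 1)" if "y > 0" for y
    using that powr_add[of y "p - 1" 2] by (simp add: G_def power_mult_distrib algebra_simps powr_numeral)
  have Eu: "(u' 0)\<^sup>2 = (u \<alpha>)\<^sup>2 * G (u \<alpha>)" and Ev: "(v' 0)\<^sup>2 = (v \<alpha>)\<^sup>2 * G (v \<alpha>)"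
    using half_sol_energy[OF u upos, of \<alpha>] half_sol_energy[OF v vpos, of \<alpha>] \<alpha> E[OF ua] E[OF va] ku kv by auto
  have u0: "0 < u' 0" and v0: "0 < v' 0" using half_sol_slope_pos u v upos vpos by auto
  have "0 < G (u \<alpha>)" using Eu u0 ua by (metis zero_less_mult_pos zero_less_power)
  moreover have "G (u \<alpha>) < G (v \<alpha>)"
    unfolding G_def using lt ua p by (intro add_strict_left_mono mult_strict_left_mono powr_less_mono2) auto
  moreover have "(u \<alpha>)\<^sup>2 < (v \<alpha>)\<^sup>2" using lt ua by (intro power_strict_mono) auto
  ultimately have energy: "(u' 0)\<^sup>2 < (v' 0)\<^sup>2"
    unfolding Eu Ev using ua by (intro mult_strict_mono) auto
  \<comment> \<open>At a common value the potential terms coincide, so the whole energy gap sits in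
    the squared slopes.\<close>
  have cross: "\<bar>u' z\<bar> < \<bar>v' z\<bar>" if "0 \<le> z" "z \<le> \<alpha>" "u z = v z" for z
  proof -
    have "(u' z)\<^sup>2 < (v' z)\<^sup>2"
      using half_sol_energy[OF u upos, of z] half_sol_energy[OF v vpos, of z] that energy by simp
    then show ?thesis using abs_le_square_iff[of "v' z" "u' z"] by linarith
  qed
  define d where "d x = v x - u x" for x
  have dd: "(d has_real_derivative v' x - u' x) (at x within {0..\<alpha>})" if "x \<in> {0..\<alpha>}" for x
    unfolding d_def by (rule DERIV_diff[OF half_solD(2)[OF v that] half_solD(2)[OF u that]])
  have contd: "continuous_on {0..\<alpha>} d" by (rule DERIV_continuous_on[OF dd])
  have d0: "d 0 = 0" and da: "0 < d \<alpha>" using lt half_solD(7)[OF u] half_solD(7)[OF v] by (auto simp: d_def)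
  have "0 < d z" if z: "0 < z" "z \<le> \<alpha>" for z
  proof (rule ccontr)
    assume "\<not> 0 < d z"
    then have dz: "d z \<le> 0" by simp
    then have "z \<noteq> \<alpha>" using da by auto
    then have dz: "d z \<le> 0" "z < \<alpha>" using dz z by auto
    \<comment> \<open>After its last zero in \<open>[z, \<alpha>]\<close> the difference is
      positive, so \<open>v' \<ge> u'\<close> at \<open>x1\<close>; together with
      \<open>\<bar>u'\<bar> < \<bar>v'\<bar>\<close> this forces \<open>v' > 0\<close>
      there.\<close>
    obtain x1 where x1: "z \<le> x1" "x1 < \<alpha>" "d x1 = 0" "\<And>x. x1 < x \<Longrightarrow> x \<le> \<alpha> \<Longrightarrow> 0 < d x"
      by (rule last_zero[of z \<alpha> d, OF continuous_on_subset[OF contd]]) (use z dz da in auto)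
    have "0 \<le> v' x1 - u' x1"
      by (rule deriv_nonneg_at_left_end[OF dd, of x1 \<alpha>]) (use x1 z in \<open>auto intro: less_imp_le\<close>)
    moreover have "\<bar>u' x1\<bar> < \<bar>v' x1\<bar>" using cross[of x1] x1 z by (simp add: d_def)
    ultimately have vx1: "0 < v' x1" by linarith
    have "0 < v' 0 - u' 0" using cross[of 0] \<alpha> u0 v0 d0 by (simp add: d_def)
    then obtain r where r: "r > 0" "\<And>h. h > 0 \<Longrightarrow> 0 + h \<in> {0..\<alpha>} \<Longrightarrow> h < r \<Longrightarrow> d 0 < d (0 + h)"
      using has_real_derivative_pos_inc_right[OF dd, of 0] \<alpha> by auto
    \<comment> \<open>The difference is positive just to the right of 0; starting the search at
      \<open>s\<close> avoids the trivial crossing at 0.\<close>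
    define s where "s = min (r/2) (z/2)"
    have s: "0 < s" "s < r" "s < z" using r(1) z by (auto simp: s_def)
    then have "0 < d s" using r(2)[of s] z d0 by auto
    \<comment> \<open>At its first zero after \<open>s\<close> the difference comes down to 0, so
      \<open>v' \<le> u'\<close>, and \<open>\<bar>u'\<bar> < \<bar>v'\<bar>\<close> gives
      \<open>v' < 0\<close>.\<close>
    then obtain x0 where x0: "s < x0" "x0 \<le> z" "d x0 = 0" "\<And>x. s \<le> x \<Longrightarrow> x < x0 \<Longrightarrow> 0 < d x"
      using first_zero[of s z d] continuous_on_subset[OF contd, of "{s..z}"] s z dz by auto
    have "v' x0 - u' x0 \<le> 0"
      by (rule deriv_nonpos_at_right_end[OF dd, of x0 s]) (use x0 z s in \<open>auto intro: less_imp_le\<close>)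
    moreover have "\<bar>u' x0\<bar> < \<bar>v' x0\<bar>" using cross[of x0] x0 z s by (simp add: d_def)
    ultimately have vx0: "v' x0 < 0" by linarith
    have "continuous_on {0..\<alpha>} v'" by (rule DERIV_continuous_on[OF half_solD(4)[OF v]])
    then have "continuous_on {x0..x1} v'"
      by (rule continuous_on_subset) (use x0 x1 s in auto)
    \<comment> \<open>Between \<open>x0\<close> and \<open>x1\<close> the slope of \<open>v\<close>
      changes from negative to positive. At its last zero \<open>x2\<close> it is about to become
      positive, so \<open>v'' \<ge> 0\<close>, against
      \<open>half_sol_concave_at_critical\<close>.\<close>
    then obtain x2 where x2: "x0 \<le> x2" "x2 < x1" "v' x2 = 0" "\<And>x. x2 < x \<Longrightarrow> x \<le> x1 \<Longrightarrow> 0 < v' x"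
      by (rule last_zero[of x0 x1 v']) (use vx0 vx1 x0 x1 in auto)
    have "0 \<le> - (lam * v x2 + v x2 powr p)"
      by (rule deriv_nonneg_at_left_end[OF half_solD(4)[OF v], of x2 x1])
        (use x2 x1 x0 s in \<open>auto intro: less_imp_le\<close>)
    moreover have "0 < lam * v x2 + v x2 powr p"
      using half_sol_concave_at_critical[OF v vpos, of x2] x2 x1 x0 s by auto
    ultimately show False by simp
  qed
  then show False using half_sol_no_ordering[OF u v upos] by (simp add: d_def)
qed

text \<open>Comparison in both directions gives equal values at \<open>\<alpha>\<close>, the common
  Robin ratio then gives equal slopes, and Cauchy uniqueness finishes.\<close>

theorem half_sol_unique:
  assumes u: "half_sol p \<alpha> lam u u'" and v: "half_sol p \<alpha> lam v v'"
    and upos: "\<And>x. 0 < x \<Longrightarrow> x \<le> 1/2 \<Longrightarrow> 0 < u x"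
    and vpos: "\<And>x. 0 < x \<Longrightarrow> x \<le> 1/2 \<Longrightarrow> 0 < v x"
    and x: "x \<in> {0..1/2}"
  shows "u x = v x"
proof -
  have eq: "u \<alpha> = v \<alpha>"
    using half_sol_le_at_interface[OF u v] half_sol_le_at_interface[OF v u] upos vpos by (meson order_antisym)
  moreover have "u' \<alpha> = v' \<alpha>"
    using half_sol_robin[OF u v] eq vpos[of \<alpha>] \<alpha> by auto
  ultimately show ?thesis using half_sol_unique_ivp[OF u v, of \<alpha> x] \<alpha> x by auto
qed

text \<open>\<open>\<Phi>\<close> is the Wronskian with the first eigenfunction
  \<open>sin (pi x)\<close> and vanishes at 0 and 1/2. Its derivative is
  \<open>(c u - u^p) sin (pi x)\<close> on the left piece and \<open>c u sin (pi x)\<close> on the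
  right one. So \<open>c \<le> 0\<close> makes it decrease in total, while
  \<open>u^(p-1) < c\<close> throughout makes it increase; both are impossible.\<close>

lemma half_sol_lam_bounds:
  assumes u: "half_sol p \<alpha> lam u u'" and pos: "\<And>x. 0 < x \<Longrightarrow> x \<le> 1/2 \<Longrightarrow> 0 < u x"
  shows "lam < pi\<^sup>2" and "\<And>M. (\<And>x. x \<in> {0..1/2} \<Longrightarrow> u x \<le> M) \<Longrightarrow> pi\<^sup>2 - lam \<le> M powr (p - 1)"
proof -
  define \<Phi> where "\<Phi> x = u' x * sin (pi * x) - pi * u x * cos (pi * x)" for x
  define c where "c = pi\<^sup>2 - lam"
  have \<Phi>0: "\<Phi> 0 = 0" "\<Phi> (1/2) = 0" using half_solD(7,8)[OF u] by (auto simp: \<Phi>_def)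
  have d1: "(\<Phi> has_real_derivative (c * u x - u x powr p) * sin (pi * x)) (at x within {0..\<alpha>})"
    if x: "x \<in> {0..\<alpha>}" for x
    unfolding \<Phi>_def c_def
    by (rule derivative_eq_intros half_solD(2)[OF u x] half_solD(4)[OF u x] refl)+ (simp add: algebra_simps power2_eq_square)
  have d2: "(\<Phi> has_real_derivative c * u x * sin (pi * x)) (at x within {\<alpha>..1/2})"
    if x: "x \<in> {\<alpha>..1/2}" for x
    unfolding \<Phi>_def c_def
    by (rule derivative_eq_intros half_solD(3)[OF u x] half_solD(5)[OF u x] refl)+ (simp add: algebra_simps power2_eq_square)
  have d1': "((\<lambda>x. - \<Phi> x) has_real_derivative - ((c * u x - u x powr p) * sin (pi * x))) (at x within {0..\<alpha>})"
    if x: "x \<in> {0..\<alpha>}" for x using d1[OF that] by (rule DERIV_minus)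
  have d2': "((\<lambda>x. - \<Phi> x) has_real_derivative - (c * u x * sin (pi * x))) (at x within {\<alpha>..1/2})"
    if x: "x \<in> {\<alpha>..1/2}" for x using d2[OF that] by (rule DERIV_minus)
  have sp: "0 < sin (pi * x)" if "0 < x" "x < 1/2" for x
    using that by (intro sin_gt_zero) (auto simp: field_simps)
  show "lam < pi\<^sup>2"
  proof (rule ccontr)
    assume "\<not> lam < pi\<^sup>2"
    then have c: "c \<le> 0" by (simp add: c_def)
    have "- \<Phi> 0 < - \<Phi> \<alpha>"
    proof (rule within_deriv_pos_imp_less[OF \<alpha>(1) d1'])
      fix x assume x: "0 < x" "x < \<alpha>"
      then have "0 < u x" "0 < sin (pi * x)" using pos sp \<alpha> by auto
      moreover have "c * u x \<le> 0" using c \<open>0 < u x\<close> by (simp add: mult_nonpos_nonneg)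
      ultimately show "0 < - ((c * u x - u x powr p) * sin (pi * x))"
        by (simp add: mult_less_0_iff) (smt (verit) powr_gt_zero)
    qed
    moreover have "- \<Phi> \<alpha> \<le> - \<Phi> (1/2)"
    proof (rule within_deriv_nonneg_imp_le[OF less_imp_le[OF \<alpha>(2)] d2'])
      fix x assume x: "\<alpha> < x" "x < 1/2"
      then have "0 < u x" "0 < sin (pi * x)" using pos sp \<alpha> by auto
      then show "0 \<le> - (c * u x * sin (pi * x))" using c by (simp add: mult_nonpos_nonneg)
    qed
    ultimately show False using \<Phi>0 by simp
  qed
  then have c: "0 < c" by (simp add: c_def)
  show "pi\<^sup>2 - lam \<le> M powr (p - 1)" if M: "\<And>x. x \<in> {0..1/2} \<Longrightarrow> u x \<le> M" for M
  proof (rule ccontr)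
    assume "\<not> pi\<^sup>2 - lam \<le> M powr (p - 1)"
    then have cM: "M powr (p - 1) < c" by (simp add: c_def)
    have "\<Phi> 0 < \<Phi> \<alpha>"
    proof (rule within_deriv_pos_imp_less[OF \<alpha>(1) d1])
      fix x assume x: "0 < x" "x < \<alpha>"
      then have ux: "0 < u x" "0 < sin (pi * x)" using pos sp \<alpha> by auto
      have "u x \<le> M" using M x \<alpha> by auto
      then have "u x powr (p - 1) \<le> M powr (p - 1)" using ux p by (intro powr_mono2) auto
      then have "u x * u x powr (p - 1) < u x * c" using cM ux by (intro mult_strict_left_mono) auto
      then have "u x powr p < c * u x" using powr_mult_base[of "u x" "p - 1"] ux by (simp add: mult.commute)
      then show "0 < (c * u x - u x powr p) * sin (pi * x)" using ux by simp
    qed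
    moreover have "\<Phi> \<alpha> \<le> \<Phi> (1/2)"
    proof (rule within_deriv_nonneg_imp_le[OF less_imp_le[OF \<alpha>(2)] d2])
      fix x assume x: "\<alpha> < x" "x < 1/2"
      then have "0 < u x" "0 < sin (pi * x)" using pos sp \<alpha> by auto
      then show "0 \<le> c * u x * sin (pi * x)" using c by simp
    qed
    ultimately show False using \<Phi>0 by simp
  qed
qed

end

section \<open>Connected graphs and compactness of bounded continuous functions\<close>

text \<open>Compactness shows that near \<open>x0\<close> the graph skips the level
  \<open>c\<close>, which lies above \<open>norm (F x0)\<close>. If the norm exceeded
  \<open>c\<close> at some nearby \<open>x1\<close>, the graph could be cut through the gap between
  \<open>x0\<close> and \<open>x1\<close>, contradicting connectedness.\<close>

lemma connected_graph_locally_bounded: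
  fixes F :: "real \<Rightarrow> 'a::real_normed_vector" and b :: real
  defines "G \<equiv> (\<lambda>x. (x, F x)) ` {..b}"
  assumes conn: "connected G"
    and comp: "\<And>M. compact (G \<inter> {z. \<bar>fst z\<bar> \<le> M \<and> norm (snd z) \<le> M})"
    and x0: "x0 \<le> b"
  obtains \<epsilon> where "0 < \<epsilon>" "\<And>x. x \<le> b \<Longrightarrow> \<bar>x - x0\<bar> < \<epsilon> \<Longrightarrow> norm (F x) < norm (F x0) + 1"
proof -
  define c where "c = norm (F x0) + 1"
  \<comment> \<open>The window is large enough to contain every graph point of norm \<open>c\<close>
    over the unit neighbourhood of \<open>x0\<close>.\<close>
  define M where "M = \<bar>x0\<bar> + 1 + c"
  have c: "0 < c" "norm (F x0) < c" by (auto simp: c_def add_nonneg_pos)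
  define K where "K = (G \<inter> {z. \<bar>fst z\<bar> \<le> M \<and> norm (snd z) \<le> M}) \<inter> {z. norm (snd z) = c}"
  have "closed {z :: real \<times> 'a. norm (snd z) = c}"
    by (intro closed_Collect_eq continuous_intros)
  then have "compact K" unfolding K_def using comp by (rule compact_Int_closed[rotated])
  then have "closed (fst ` K)"
    by (intro compact_imp_closed compact_continuous_image continuous_intros)
  moreover have "x0 \<notin> fst ` K" using c by (auto simp: K_def G_def)
  ultimately obtain e where e: "e > 0" "ball x0 e \<subseteq> - fst ` K"
    using openE[of "- fst ` K" x0] by (auto simp: open_Compl)
  define \<epsilon> where "\<epsilon> = min e 1"
  have \<epsilon>: "\<epsilon> > 0" using e by (simp add: \<epsilon>_def)
  have ne: "norm (F x) \<noteq> c" if "x \<le> b" "\<bar>x - x0\<bar> < \<epsilon>" for x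
  proof
    assume "norm (F x) = c"
    moreover have "\<bar>x\<bar> \<le> M" using that c unfolding M_def \<epsilon>_def by linarith
    ultimately have "(x, F x) \<in> K" using that c by (auto simp: K_def G_def M_def)
    then have "x \<in> fst ` K" by force
    moreover have "x \<in> ball x0 e" using that by (simp add: \<epsilon>_def dist_real_def abs_minus_commute)
    ultimately show False using e(2) by blast
  qed
  have "norm (F x1) < c" if x1: "x1 \<le> b" "\<bar>x1 - x0\<bar> < \<epsilon>" for x1
  proof (rule ccontr)
    assume "\<not> norm (F x1) < c"
    then have big: "c < norm (F x1)" using ne[OF x1] by simp
    then have "x1 \<noteq> x0" using c by auto
    then consider "x0 < x1" | "x1 < x0" by linarith
    then show False
    proof cases
      case 1
      \<comment> \<open>The cut runs vertically at \<open>x0\<close> above level \<open>c\<close>,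
        then along level \<open>c\<close> up to \<open>x1\<close>, then vertically at
        \<open>x1\<close> below it. The graph avoids all three pieces: it is below \<open>c\<close>
        at \<open>x0\<close>, skips \<open>c\<close> in between, and is above \<open>c\<close> at
        \<open>x1\<close>.\<close>
      define A where "A = {z :: real \<times> 'a. x0 < fst z} \<inter> ({z. c < norm (snd z)} \<union> {z. x1 < fst z})"
      define B where "B = {z :: real \<times> 'a. fst z < x0} \<union> ({z. norm (snd z) < c} \<inter> {z. fst z < x1})"
      have "open A" "open B" unfolding A_def B_def
        by (intro open_Int open_Un open_Collect_less continuous_intros)+
      moreover have "A \<inter> B \<inter> G = {}" by (auto simp: A_def B_def)
      moreover have "G \<subseteq> A \<union> B"
      proof
        fix z assume "z \<in> G"
        then obtain x where x: "x \<le> b" "z = (x, F x)" by (auto simp: G_def)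
        show "z \<in> A \<union> B"
          using ne[of x] x x1 c big 1
          by (cases x x0 rule: linorder_cases; cases x x1 rule: linorder_cases) (auto simp: A_def B_def)
      qed
      ultimately have "A \<inter> G = {} \<or> B \<inter> G = {}" using connectedD[OF conn] by blast
      moreover have "(x1, F x1) \<in> A \<inter> G" using 1 big x1 by (auto simp: A_def G_def)
      moreover have "(x0, F x0) \<in> B \<inter> G" using 1 c x0 by (auto simp: B_def G_def)
      ultimately show False by blast
    next
      case 2
      define A where "A = {z :: real \<times> 'a. fst z < x0} \<inter> ({z. c < norm (snd z)} \<union> {z. fst z < x1})"
      define B where "B = {z :: real \<times> 'a. x0 < fst z} \<union> ({z. norm (snd z) < c} \<inter> {z. x1 < fst z})"
      have "open A" "open B" unfolding A_def B_def
        by (intro open_Int open_Un open_Collect_less continuous_intros)+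
      moreover have "A \<inter> B \<inter> G = {}" by (auto simp: A_def B_def)
      moreover have "G \<subseteq> A \<union> B"
      proof
        fix z assume "z \<in> G"
        then obtain x where x: "x \<le> b" "z = (x, F x)" by (auto simp: G_def)
        show "z \<in> A \<union> B"
          using ne[of x] x x1 c big 2
          by (cases x x0 rule: linorder_cases; cases x x1 rule: linorder_cases) (auto simp: A_def B_def)
      qed
      ultimately have "A \<inter> G = {} \<or> B \<inter> G = {}" using connectedD[OF conn] by blast
      moreover have "(x1, F x1) \<in> A \<inter> G" using 2 big x1 by (auto simp: A_def G_def)
      moreover have "(x0, F x0) \<in> B \<inter> G" using 2 c x0 by (auto simp: B_def G_def)
      ultimately show False by blast
    qed
  qed
  then show ?thesis using that[of \<epsilon>] \<epsilon> by (simp add: c_def)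
qed

text \<open>By local boundedness the graph over a small closed neighbourhood of \<open>x0\<close>
  lies in a compact part and is itself compact. The first projection is a continuous injection on
  it, so its inverse \<open>x \<mapsto> (x, F x)\<close> is continuous.\<close>

lemma connected_graph_imp_continuous:
  fixes F :: "real \<Rightarrow> 'a::real_normed_vector" and b :: real
  defines "G \<equiv> (\<lambda>x. (x, F x)) ` {..b}"
  assumes conn: "connected G"
    and comp: "\<And>M. compact (G \<inter> {z. \<bar>fst z\<bar> \<le> M \<and> norm (snd z) \<le> M})"
  shows "continuous_on {..b} F"
  unfolding continuous_on_eq_continuous_within
proof
  fix x0 assume x0: "x0 \<in> {..b}"
  obtain \<epsilon> where \<epsilon>: "0 < \<epsilon>" "\<And>x. x \<le> b \<Longrightarrow> \<bar>x - x0\<bar> < \<epsilon> \<Longrightarrow> norm (F x) < norm (F x0) + 1"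
    using connected_graph_locally_bounded[of F b x0] conn comp x0 unfolding G_def by auto
  define M where "M = \<bar>x0\<bar> + \<epsilon> + norm (F x0) + 1"
  define K where "K = G \<inter> {z. \<bar>fst z\<bar> \<le> M \<and> norm (snd z) \<le> M}"
  have K: "compact K" unfolding K_def by (rule comp)
  define S where "S = {..b} \<inter> cball x0 (\<epsilon>/2)"
  have inK: "(x, F x) \<in> K" if "x \<in> S" for x
  proof -
    have x: "x \<le> b" "\<bar>x - x0\<bar> \<le> \<epsilon>/2" using that by (auto simp: S_def dist_real_def abs_minus_commute)
    then have "norm (F x) < norm (F x0) + 1" using \<epsilon> by auto
    then have "norm (F x) \<le> M" "\<bar>x\<bar> \<le> M"
      using x \<epsilon>(1) norm_ge_zero[of "F x0"] unfolding M_def by linarith+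
    then show ?thesis using x by (auto simp: K_def G_def)
  qed
  have graph: "(\<lambda>x. (x, F x)) ` S = K \<inter> (S \<times> UNIV)"
  proof
    show "(\<lambda>x. (x, F x)) ` S \<subseteq> K \<inter> (S \<times> UNIV)" using inK by force
    show "K \<inter> (S \<times> UNIV) \<subseteq> (\<lambda>x. (x, F x)) ` S" by (auto simp: K_def G_def)
  qed
  have "continuous_on (fst ` (\<lambda>x. (x, F x)) ` S) (\<lambda>x. (x, F x))"
  proof (rule continuous_on_inv)
    show "compact ((\<lambda>x. (x, F x)) ` S)" unfolding graph
      by (intro compact_Int_closed K closed_Times) (auto simp: S_def)
  qed (auto intro!: continuous_intros)
  then have "continuous_on S (\<lambda>x. snd (x, F x))"
    by (intro continuous_on_snd) (simp add: image_image)
  then have "continuous_on S F" by simp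
  moreover have x0S: "x0 \<in> S" using x0 \<epsilon> by (simp add: S_def)
  moreover have "at x0 within S = at x0 within {..b}"
    by (rule at_within_nhd[of _ "ball x0 (\<epsilon>/2)"]) (use \<epsilon> in \<open>auto simp: S_def\<close>)
  ultimately show "continuous (at x0 within {..b}) F"
    unfolding continuous_on_eq_continuous_within by metis
qed

section \<open>Clamped functions and sequential compactness in the sup norm\<close>

lemma emb01_apply:
  assumes "continuous_on {0..1} u"
  shows "apply_bcontfun (emb01 u) x = u (max 0 (min 1 x))"
proof -
  have "(\<lambda>x. u (max 0 (min 1 x))) \<in> bcontfun"
    unfolding bcontfun_def
  proof (intro CollectI conjI)
    show "continuous_on UNIV (\<lambda>x. u (max 0 (min 1 x)))"
      by (rule continuous_on_compose2[OF assms]) (auto intro!: continuous_intros)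
    have "bounded (u ` {0..1})"
      by (intro compact_imp_bounded compact_continuous_image assms) auto
    then show "bounded (range (\<lambda>x. u (max 0 (min 1 x))))"
      by (rule bounded_subset) auto
  qed
  then show ?thesis by (simp add: emb01_def Bcontfun_inverse)
qed

text \<open>Arzela-Ascoli gives uniform convergence on \<open>[0, 1]\<close> only; the clamping
  hypothesis transports it to the whole line, where the sup norm of the ambient space is
  taken.\<close>

lemma Lipschitz_convergent_subseq:
  fixes f :: "nat \<Rightarrow> real \<Rightarrow>\<^sub>C real"
  assumes clamp: "\<And>n x. f n x = f n (max 0 (min 1 x))"
    and bound: "\<And>n. norm (f n) \<le> M"
    and Lip: "\<And>n x y. x \<in> {0..1} \<Longrightarrow> y \<in> {0..1} \<Longrightarrow> \<bar>f n x - f n y\<bar> \<le> L * \<bar>x - y\<bar>"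
  obtains l k where "strict_mono (k :: nat \<Rightarrow> nat)" "(\<lambda>n. f (k n)) \<longlonglongrightarrow> l"
proof -
  have M: "norm (f n x) \<le> M" for n x
    using norm_bounded[of "f n" x] bound[of n] by linarith
  have equi: "\<exists>d. 0 < d \<and> (\<forall>n y. y \<in> {0..1} \<and> norm (x - y) < d \<longrightarrow> norm (f n x - f n y) < e)"
    if "x \<in> {0..1}" "0 < e" for x e
  proof (intro exI conjI allI impI)
    show "0 < e / (\<bar>L\<bar> + 1)" using that by (intro divide_pos_pos) auto
    fix n y assume y: "y \<in> {0..1} \<and> norm (x - y) < e / (\<bar>L\<bar> + 1)"
    have "\<bar>f n x - f n y\<bar> \<le> L * \<bar>x - y\<bar>" using Lip that y by auto
    also have "\<dots> \<le> (\<bar>L\<bar> + 1) * \<bar>x - y\<bar>" by (intro mult_right_mono) auto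
    also have "\<dots> < e" using y by (simp add: field_simps)
    finally show "norm (f n x - f n y) < e" by simp
  qed
  obtain g k where g: "strict_mono (k :: nat \<Rightarrow> nat)"
    "\<And>e. 0 < e \<Longrightarrow> \<exists>N. \<forall>n x. N \<le> n \<and> x \<in> {0..1} \<longrightarrow> norm (f (k n) x - g x) < e"
    using Arzela_Ascoli[of "{0..1}" "\<lambda>n. apply_bcontfun (f n)" M] M equi by (metis compact_Icc)
  have "uniform_limit UNIV (\<lambda>n. apply_bcontfun (f (k n))) (\<lambda>x. g (max 0 (min 1 x))) sequentially"
  proof (rule uniform_limitI)
    fix e :: real assume "e > 0"
    then obtain N where N: "\<And>n x. N \<le> n \<Longrightarrow> x \<in> {0..1} \<Longrightarrow> norm (f (k n) x - g x) < e"
      using g(2) by blast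
    have "dist (f (k n) x) (g (max 0 (min 1 x))) < e" if "N \<le> n" for n x
      using N[OF that, of "max 0 (min 1 x)"] clamp[of "k n" x] by (simp add: dist_norm)
    then show "\<forall>\<^sub>F n in sequentially. \<forall>x\<in>UNIV. dist (f (k n) x) (g (max 0 (min 1 x))) < e"
      by (auto simp: eventually_sequentially)
  qed
  then show ?thesis
    using uniform_limit_bcontfunE[of "\<lambda>n. f (k n)"] that[of k] g(1) by (metis sequentially_bot)
qed

section \<open>Integral form of the equation\<close>

definition rhs :: "real \<Rightarrow> real \<Rightarrow> real \<Rightarrow> (real \<Rightarrow> real) \<Rightarrow> real \<Rightarrow> real" where
  "rhs p h lam u x = lam * u x + a_h h x * u x powr p"

text \<open>The equation integrated once. This form contains no almost-everywhere derivative and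
  passes to pointwise limits by dominated convergence.\<close>

definition int_sol :: "real \<Rightarrow> real \<Rightarrow> real \<Rightarrow> (real \<Rightarrow> real) \<Rightarrow> (real \<Rightarrow> real) \<Rightarrow> bool" where
  "int_sol p h lam u u' \<longleftrightarrow>
     (\<forall>x\<in>{0..1}. (u has_real_derivative u' x) (at x within {0..1})) \<and>
     (\<forall>x\<in>{0..1}. (rhs p h lam u has_integral (u' 0 - u' x)) {0..x}) \<and>
     u 0 = 0 \<and> u 1 = 0"

lemma is_sol_imp_int_sol:
  assumes "is_sol p h lam u"
  obtains u' where "int_sol p h lam u u'"
proof -
  obtain u' where u: "\<forall>x\<in>{0..1}. (u has_real_derivative u' x) (at x within {0..1})"
    and ac: "abs_cont_on 0 1 u'"
    and ae: "AE x in lebesgue. x \<in> {0<..<1} \<longrightarrow> (u' has_real_derivative - rhs p h lam u x) (at x)"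
    and bc: "u 0 = 0" "u 1 = 0"
    using assms unfolding is_sol_def rhs_def by auto
  obtain N0 where N0: "N0 \<in> null_sets lebesgue"
    "\<And>x. x \<in> {0<..<1} \<Longrightarrow> x \<notin> N0 \<Longrightarrow> (u' has_real_derivative - rhs p h lam u x) (at x)"
    using ae unfolding eventually_ae_filter by auto
  \<comment> \<open>The equation is known only inside \<open>(0, 1)\<close>, so both endpoints join
    the exceptional null set.\<close>
  define N where "N = N0 \<union> {0,1}"
  have N: "negligible N" using N0(1) by (simp add: N_def negligible_iff_null_sets[symmetric])
  have "(rhs p h lam u has_integral (u' 0 - u' x)) {0..x}" if x: "x \<in> {0..1}" for x
  proof -
    have "((\<lambda>y. - rhs p h lam u y) has_integral (u' x - u' 0)) {0..x}"
    proof (rule abs_cont_has_integral[OF _ _ N])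
      show "abs_cont_on 0 x u'"
        unfolding abs_cont_on_def
      proof (intro allI impI)
        fix e :: real assume "e > 0"
        show "\<exists>\<delta>>0. \<forall>(n::nat) a b. (\<forall>i<n. 0 \<le> a i \<and> a i \<le> b i \<and> b i \<le> x) \<longrightarrow>
          (\<forall>i<n. \<forall>j<n. i \<noteq> j \<longrightarrow> b i \<le> a j \<or> b j \<le> a i) \<longrightarrow>
          (\<Sum>i<n. b i - a i) < \<delta> \<longrightarrow> (\<Sum>i<n. \<bar>u' (b i) - u' (a i)\<bar>) < e"
          using ac[unfolded abs_cont_on_def, THEN spec, THEN mp, OF \<open>e > 0\<close>]
        proof (elim exE conjE, intro exI conjI allI impI)
          fix \<delta> :: real and n :: nat and a b :: "nat \<Rightarrow> real"
          assume *: "\<forall>(n::nat) a b. (\<forall>i<n. 0 \<le> a i \<and> a i \<le> b i \<and> b i \<le> 1) \<longrightarrow>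
            (\<forall>i<n. \<forall>j<n. i \<noteq> j \<longrightarrow> b i \<le> a j \<or> b j \<le> a i) \<longrightarrow>
            (\<Sum>i<n. b i - a i) < \<delta> \<longrightarrow> (\<Sum>i<n. \<bar>u' (b i) - u' (a i)\<bar>) < e"
            and ab: "\<forall>i<n. 0 \<le> a i \<and> a i \<le> b i \<and> b i \<le> x"
            "\<forall>i<n. \<forall>j<n. i \<noteq> j \<longrightarrow> b i \<le> a j \<or> b j \<le> a i"
            "(\<Sum>i<n. b i - a i) < \<delta>"
          have "\<forall>i<n. 0 \<le> a i \<and> a i \<le> b i \<and> b i \<le> 1" using ab(1) x by fastforce
          then show "(\<Sum>i<n. \<bar>u' (b i) - u' (a i)\<bar>) < e" 
            by (rule *[THEN spec, THEN spec, THEN spec, THEN mp, THEN mp, THEN mp, OF _ ab(2,3)])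
        qed
      qed
      show "(u' has_real_derivative - rhs p h lam u y) (at y within {0..x})" if "y \<in> {0..x} - N" for y
      proof -
        have "(u' has_real_derivative - rhs p h lam u y) (at y)"
          using N0(2)[of y] that x by (auto simp: N_def less_le)
        then show ?thesis by (rule has_field_derivative_at_within)
      qed
    qed (use x in auto)
    from has_integral_neg[OF this] show ?thesis by simp
  qed
  then show ?thesis using that[of u'] u bc by (simp add: int_sol_def)
qed

lemma int_sol_continuous: "int_sol p h lam u u' \<Longrightarrow> continuous_on {0..1} u"
  unfolding int_sol_def by (auto intro!: DERIV_continuous_on)

lemma has_integral_increment:
  fixes f w :: "real \<Rightarrow> real"
  assumes int: "\<And>x. x \<in> {0..1} \<Longrightarrow> (f has_integral (w 0 - w x)) {0..x}"
    and xy: "0 \<le> x" "x \<le> y" "y \<le> 1"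
  shows "(f has_integral (w x - w y)) {x..y}"
proof -
  have "f integrable_on {x..y}"
    by (rule integrable_on_subinterval[of _ "{0..y}"]) (use int[of y] xy in \<open>auto simp: integrable_on_def\<close>)
  then obtain j where j: "(f has_integral j) {x..y}" by blast
  have "(f has_integral (w 0 - w x + j)) {0..y}"
    by (rule has_integral_combine[OF _ _ int j]) (use xy in auto)
  then have "w 0 - w x + j = w 0 - w y"
    using int[of y] xy by (intro has_integral_unique) auto
  then have "j = w x - w y" by simp
  then show ?thesis using j by simp
qed

lemma has_integral_bounded_imp_Lipschitz:
  fixes f w :: "real \<Rightarrow> real"
  assumes int: "\<And>x. x \<in> {0..1} \<Longrightarrow> (f has_integral (w 0 - w x)) {0..x}"
    and B: "\<And>x. x \<in> {0..1} \<Longrightarrow> \<bar>f x\<bar> \<le> B"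
    and xy: "x \<in> {0..1}" "y \<in> {0..1}"
  shows "\<bar>w y - w x\<bar> \<le> B * \<bar>y - x\<bar>"
proof -
  have B0: "0 \<le> B" using B[of 0] by simp
  have *: "\<bar>w y - w x\<bar> \<le> B * \<bar>y - x\<bar>" if "0 \<le> x" "x \<le> y" "y \<le> 1" for x y
  proof -
    have "norm (w x - w y) \<le> B * content (cbox x y)"
      by (rule has_integral_bound[OF B0])
        (use has_integral_increment[OF int that] B that in \<open>auto simp: box_real\<close>)
    then show ?thesis using that by simp
  qed
  show ?thesis using *[of x y] *[of y x] xy by (cases "x \<le> y") (auto simp: abs_minus_commute)
qed

lemma integral_form_has_derivative:
  fixes g w :: "real \<Rightarrow> real"
  assumes cont: "continuous_on {a..b} g"
    and int: "\<And>x. x \<in> {a..b} \<Longrightarrow> (g has_integral (w a - w x)) {a..x}" and x: "x \<in> {a..b}"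
  shows "(w has_real_derivative - g x) (at x within {a..b})"
proof -
  have "((\<lambda>y. w a - integral {a..y} g) has_real_derivative 0 - g x) (at x within {a..b})"
    by (rule DERIV_diff[OF DERIV_const integral_has_real_derivative[OF cont x]])
  moreover have "w a - integral {a..y} g = w y" if "y \<in> {a..b}" for y
    using integral_unique[OF int[OF that]] by simp
  ultimately show ?thesis
    using has_field_derivative_transform_within[of "\<lambda>y. w a - integral {a..y} g" _ x "{a..b}" 1 w] x by simp
qed

lemma rhs_bound:
  assumes "0 \<le> u x" "u x \<le> M" "p > 1"
  shows "\<bar>rhs p h lam u x\<bar> \<le> \<bar>lam\<bar> * M + M powr p"
proof -
  have "\<bar>lam * u x\<bar> \<le> \<bar>lam\<bar> * M" using assms by (simp add: abs_mult mult_left_mono)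
  moreover have "\<bar>a_h h x * u x powr p\<bar> \<le> 1 * M powr p"
    unfolding abs_mult using assms powr_mono2[of p "u x" M] by (intro mult_mono) (auto simp: a_h_def)
  ultimately show ?thesis unfolding rhs_def by (simp add: abs_triangle_ineq[THEN order_trans])
qed

lemma Lipschitz_imp_abs_cont_on:
  fixes w :: "real \<Rightarrow> real"
  assumes "\<And>x y. x \<in> {c..d} \<Longrightarrow> y \<in> {c..d} \<Longrightarrow> \<bar>w y - w x\<bar> \<le> B * \<bar>y - x\<bar>"
  shows "abs_cont_on c d w"
  unfolding abs_cont_on_def
proof (intro allI impI)
  fix e :: real assume "e > 0"
  define C where "C = \<bar>B\<bar> + 1"
  have C: "C > 0" by (simp add: C_def add_nonneg_pos)
  show "\<exists>\<delta>>0. \<forall>(n::nat) a b. (\<forall>i<n. c \<le> a i \<and> a i \<le> b i \<and> b i \<le> d) \<longrightarrow>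
      (\<forall>i<n. \<forall>j<n. i \<noteq> j \<longrightarrow> b i \<le> a j \<or> b j \<le> a i) \<longrightarrow>
      (\<Sum>i<n. b i - a i) < \<delta> \<longrightarrow> (\<Sum>i<n. \<bar>w (b i) - w (a i)\<bar>) < e"
  proof (intro exI[of _ "e / C"] conjI allI impI)
    show "0 < e / C" using C \<open>e > 0\<close> by simp
    fix n :: nat and a b :: "nat \<Rightarrow> real"
    assume ab: "\<forall>i<n. c \<le> a i \<and> a i \<le> b i \<and> b i \<le> d" and lt: "(\<Sum>i<n. b i - a i) < e / C"
    have "(\<Sum>i<n. \<bar>w (b i) - w (a i)\<bar>) \<le> (\<Sum>i<n. C * (b i - a i))"
    proof (rule sum_mono)
      fix i assume "i \<in> {..<n}"
      then have i: "c \<le> a i" "a i \<le> b i" "b i \<le> d" using ab by auto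
      then have "\<bar>w (b i) - w (a i)\<bar> \<le> B * \<bar>b i - a i\<bar>" by (intro assms) auto
      also have "\<dots> \<le> C * (b i - a i)" using i by (simp add: C_def mult_right_mono)
      finally show "\<bar>w (b i) - w (a i)\<bar> \<le> C * (b i - a i)" .
    qed
    also have "\<dots> < e" unfolding sum_distrib_left[symmetric] using lt C
      by (simp add: pos_less_divide_eq mult.commute)
    finally show "(\<Sum>i<n. \<bar>w (b i) - w (a i)\<bar>) < e" .
  qed
qed

section \<open>From the integral form back to absolutely continuous derivatives\<close>

context
  fixes p h :: real
  assumes p: "p > 1" and h: "0 < h" "h < 1"
begin

lemma isCont_a_h:
  assumes "x \<in> {0<..<1} - {(1-h)/2, (1+h)/2}"
  shows "isCont (a_h h) x"
proof -
  have "\<exists>S c. open S \<and> x \<in> S \<and> (\<forall>y\<in>S. a_h h y = c)"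
  proof -
    consider "x < (1-h)/2" | "(1-h)/2 < x" "x < (1+h)/2" | "(1+h)/2 < x" using assms by fastforce
    then show ?thesis
    proof cases
      case 1
      then show ?thesis using assms h
        by (intro exI[of _ "{0<..<(1-h)/2}"] exI[of _ 1]) (auto simp: a_h_def)
    next
      case 2
      then show ?thesis using assms h
        by (intro exI[of _ "{(1-h)/2<..<(1+h)/2}"] exI[of _ 0]) (auto simp: a_h_def)
    next
      case 3
      then show ?thesis using assms h
        by (intro exI[of _ "{(1+h)/2<..<1}"] exI[of _ 1]) (auto simp: a_h_def)
    qed
  qed
  then obtain S c where S: "open S" "x \<in> S" "\<And>y. y \<in> S \<Longrightarrow> a_h h y = c" by blast
  then have "\<forall>\<^sub>F y in nhds x. a_h h y = c" by (auto simp: eventually_nhds)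
  then show ?thesis using isCont_cong[of "a_h h" "\<lambda>_. c" x] by simp
qed

text \<open>A bounded right-hand side makes \<open>u'\<close> Lipschitz, hence absolutely
  continuous. The integral can be differentiated wherever the right-hand side is continuous, that
  is, off the two jumps of the coefficient.\<close>

lemma int_sol_imp_is_sol:
  assumes u: "int_sol p h lam u u'" and nn: "\<And>x. x \<in> {0..1} \<Longrightarrow> 0 \<le> u x"
  shows "is_sol p h lam u"
proof -
  have contu: "continuous_on {0..1} u" using int_sol_continuous[OF u] .
  have int: "(rhs p h lam u has_integral (u' 0 - u' x)) {0..x}" if "x \<in> {0..1}" for x
    using u that by (simp add: int_sol_def)
  have "bdd_above (u ` {0..1})"
    by (intro bounded_imp_bdd_above compact_imp_bounded compact_continuous_image contu) auto
  then obtain M where M: "\<forall>x\<in>{0..1}. u x \<le> M" by (auto simp: bdd_above_def)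
  have Lip: "\<bar>u' y - u' x\<bar> \<le> (\<bar>lam\<bar> * M + M powr p) * \<bar>y - x\<bar>" if "x \<in> {0..1}" "y \<in> {0..1}" for x y
  proof (rule has_integral_bounded_imp_Lipschitz[of "rhs p h lam u" u', OF int _ that])
    show "\<bar>rhs p h lam u x\<bar> \<le> \<bar>lam\<bar> * M + M powr p" if "x \<in> {0..1}" for x
      using nn[OF that] M that p by (intro rhs_bound) auto
  qed
  then have ac: "abs_cont_on 0 1 u'" by (rule Lipschitz_imp_abs_cont_on)
  have "(\<bar>lam\<bar> * M + M powr p)-lipschitz_on {0..1} u'"
  proof -
    have "u 0 \<le> M" "0 \<le> u 0" using M nn by auto
    then have "0 \<le> M" by linarith
    then show ?thesis using Lip by (auto simp: lipschitz_on_def dist_real_def)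
  qed
  then have contu': "continuous_on {0..1} u'" by (rule lipschitz_on_continuous_on)
  have null: "{(1-h)/2,(1+h)/2} \<in> null_sets lebesgue"
    by (auto simp: negligible_iff_null_sets[symmetric])
  have der: "(u' has_real_derivative - rhs p h lam u x) (at x)"
    if x: "x \<in> {0<..<1}" "x \<notin> {(1-h)/2,(1+h)/2}" for x
  proof -
    have "isCont u x"
      by (rule continuous_on_interior[OF contu]) (use x in auto)
    moreover have "isCont (a_h h) x" using isCont_a_h x by auto
    moreover have "\<forall>\<^sub>F y in at x. 0 \<le> u y"
    proof -
      have "\<forall>\<^sub>F y in at x. y \<in> {0<..<1}" by (rule eventually_at_in_open') (use x in auto)
      then show ?thesis by eventually_elim (use nn in auto)
    qed
    ultimately have "isCont (rhs p h lam u) x"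
      unfolding isCont_def rhs_def using p
      by (intro tendsto_add tendsto_mult tendsto_powr2 tendsto_const) auto
    then have c: "continuous (at x within {0..1} - {}) (rhs p h lam u)"
      by (rule continuous_at_imp_continuous_at_within)
    have "rhs p h lam u integrable_on {0..1}" using int[of 1] by auto
    then have "((\<lambda>t. integral {0..t} (rhs p h lam u)) has_vector_derivative rhs p h lam u x) (at x within {0..1} - {})"
      by (rule integral_has_vector_derivative_continuous_at[OF _ _ _ c]) (use x in auto)
    then have "((\<lambda>t. u' 0 - integral {0..t} (rhs p h lam u)) has_real_derivative 0 - rhs p h lam u x) (at x within {0..1})"
      by (intro DERIV_diff DERIV_const) (simp add: has_real_derivative_iff_has_vector_derivative)
    moreover have "u' 0 - integral {0..t} (rhs p h lam u) = u' t" if "t \<in> {0..1}" for t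
      using integral_unique[OF int[OF that]] by simp
    ultimately have "(u' has_real_derivative - rhs p h lam u x) (at x within {0..1})"
      using has_field_derivative_transform_within[of "\<lambda>t. u' 0 - integral {0..t} (rhs p h lam u)" _ x "{0..1}" 1 u'] x
      by simp
    then show ?thesis using x by (simp add: at_within_Icc_at)
  qed
  have "AE x in lebesgue. x \<notin> {(1-h)/2,(1+h)/2}" using null by (rule AE_not_in)
  then have ae: "AE x in lebesgue. x \<in> {0<..<1} \<longrightarrow> (u' has_real_derivative - rhs p h lam u x) (at x)"
    by (rule AE_mp) (intro always_eventually allI impI der)
  show ?thesis
    unfolding is_sol_def rhs_def[symmetric]
    using u contu' ac ae by (intro conjI exI[of _ u']) (auto simp: int_sol_def)
qed

end

section \<open>Limits of symmetric positive solutions\<close>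

context
  fixes p h :: real
  assumes p: "p > 1" and h: "0 < h" "h < 1"
begin

lemma int_sol_half_sol:
  assumes u: "int_sol p h lam u u'" and nn: "\<And>x. x \<in> {0..1} \<Longrightarrow> 0 \<le> u x"
    and sym: "\<And>x. x \<in> {0..1} \<Longrightarrow> u x = u (1 - x)"
  shows "half_sol p ((1-h)/2) lam u u'"
proof -
  define \<alpha> where "\<alpha> = (1-h)/2"
  have \<alpha>: "0 < \<alpha>" "\<alpha> < 1/2" using h by (auto simp: \<alpha>_def)
  have contu: "continuous_on {0..1} u" using int_sol_continuous[OF u] .
  have du: "(u has_real_derivative u' x) (at x within {0..1})" if "x \<in> {0..1}" for x
    using u that by (simp add: int_sol_def)
  have int: "(rhs p h lam u has_integral (u' 0 - u' x)) {0..x}" if "x \<in> {0..1}" for x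
    using u that by (simp add: int_sol_def)
  have "(u' has_real_derivative - (lam * u x + u x powr p)) (at x within {0..\<alpha>})" if x: "x \<in> {0..\<alpha>}" for x
  proof (rule integral_form_has_derivative[OF _ _ x])
    show "continuous_on {0..\<alpha>} (\<lambda>x. lam * u x + u x powr p)"
      using p nn \<alpha> by (intro continuous_intros continuous_on_powr' continuous_on_subset[OF contu]) auto
    show "((\<lambda>x. lam * u x + u x powr p) has_integral (u' 0 - u' y)) {0..y}" if "y \<in> {0..\<alpha>}" for y
      by (rule has_integral_eq[OF _ int]) (use that \<alpha> in \<open>auto simp: rhs_def a_h_def \<alpha>_def\<close>)
  qed
  moreover have "(u' has_real_derivative - (lam * u x)) (at x within {\<alpha>..1/2})" if x: "x \<in> {\<alpha>..1/2}" for x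
  proof (rule integral_form_has_derivative[OF _ _ x])
    show "continuous_on {\<alpha>..1/2} (\<lambda>x. lam * u x)"
      using \<alpha> by (intro continuous_intros continuous_on_subset[OF contu]) auto
    show "((\<lambda>x. lam * u x) has_integral (u' \<alpha> - u' y)) {\<alpha>..y}" if "y \<in> {\<alpha>..1/2}" for y
    proof (rule has_integral_spike_finite)
      show "(rhs p h lam u has_integral (u' \<alpha> - u' y)) {\<alpha>..y}"
        by (rule has_integral_increment[OF int]) (use that \<alpha> in auto)
      \<comment> \<open>At \<open>\<alpha>\<close> itself the coefficient still equals 1; this
        single point does not affect the integral.\<close>
      show "lam * u z = rhs p h lam u z" if "z \<in> {\<alpha>..y} - {\<alpha>}" for z
        using that \<open>y \<in> {\<alpha>..1/2}\<close> h by (auto simp: rhs_def a_h_def \<alpha>_def)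
    qed auto
  qed
  \<comment> \<open>Reflection maps 1/2 to itself and reverses the slope, so symmetry gives
    \<open>u' (1/2) = - u' (1/2)\<close>.\<close>
  moreover have "u' (1/2) = 0"
  proof -
    have d: "(u has_real_derivative u' (1/2)) (at (1/2))"
      using du[of "1/2"] by (simp add: at_within_Icc_at)
    have "((\<lambda>x. u (1 - x)) has_real_derivative u' (1/2) * (0 - 1)) (at (1/2))"
    proof (rule DERIV_chain2[where f = u])
      show "(u has_real_derivative u' (1/2)) (at (1 - 1/2))" using d by simp
      show "((-) 1 has_real_derivative 0 - 1) (at (1/2))" by (intro DERIV_diff DERIV_const DERIV_ident)
    qed
    then have "(u has_real_derivative u' (1/2) * (0 - 1)) (at (1/2))"
    proof (rule has_field_derivative_transform_within_open[of _ _ _ "{0<..<1}"])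
      show "u (1 - x) = u x" if "x \<in> {0<..<1}" for x using sym[of x] that by simp
    qed auto
    from DERIV_unique[OF d this] show ?thesis by simp
  qed
  moreover have "(u has_real_derivative u' x) (at x within {0..1/2})" if "x \<in> {0..1/2}" for x
    by (rule DERIV_subset[OF du]) (use that in auto)
  moreover have "u 0 = 0" using u by (simp add: int_sol_def)
  ultimately show ?thesis unfolding half_sol_def \<alpha>_def[symmetric] using nn by auto
qed

section \<open>Uniqueness and bounds for symmetric positive solutions\<close>

lemma sym_pos_solD:
  assumes "sym_pos_sol p h lam u"
  shows "\<exists>u'. int_sol p h lam u u' \<and> half_sol p ((1-h)/2) lam u u'"
    and "\<And>x. 0 < x \<Longrightarrow> x \<le> 1/2 \<Longrightarrow> 0 < u x" and "\<And>x. x \<in> {0..1} \<Longrightarrow> 0 \<le> u x"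
    and "\<And>x. x \<in> {0..1} \<Longrightarrow> u x = u (1 - x)" and "continuous_on {0..1} u"
proof -
  have sol: "is_sol p h lam u" and pos: "\<And>x. 0 < x \<Longrightarrow> x < 1 \<Longrightarrow> 0 < u x" and bc: "u 0 = 0" "u 1 = 0"
    using assms unfolding sym_pos_sol_def is_sol_def by (auto simp only: greaterThanLessThan_iff)
  show sym: "u x = u (1 - x)" if "x \<in> {0..1}" for x
    using assms that unfolding sym_pos_sol_def by blast
  show nn: "0 \<le> u x" if "x \<in> {0..1}" for x
    using pos[of x] bc that by (cases "x = 0"; cases "x = 1") auto
  obtain u' where u': "int_sol p h lam u u'" using is_sol_imp_int_sol[OF sol] .
  show "0 < u x" if "0 < x" "x \<le> 1/2" for x using pos that by auto
  show "continuous_on {0..1} u" by (rule int_sol_continuous[OF u'])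
  show "\<exists>u'. int_sol p h lam u u' \<and> half_sol p ((1-h)/2) lam u u'"
    using u' int_sol_half_sol[OF u' nn sym] by (intro exI conjI)
qed

lemma interface_bounds: "0 < (1-h)/2" "(1-h)/2 < 1/2"
  using h by auto

lemma sym_pos_sol_unique:
  assumes u: "sym_pos_sol p h lam u" and v: "sym_pos_sol p h lam v"
  shows "emb01 u = emb01 v"
proof -
  obtain u' where u': "half_sol p ((1-h)/2) lam u u'" using sym_pos_solD(1)[OF u] by blast
  obtain v' where v': "half_sol p ((1-h)/2) lam v v'" using sym_pos_solD(1)[OF v] by blast
  have half: "u x = v x" if "x \<in> {0..1/2}" for x
    by (rule half_sol_unique[OF p interface_bounds u' v' sym_pos_solD(2)[OF u] sym_pos_solD(2)[OF v] that])
  have "u x = v x" if "x \<in> {0..1}" for x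
    using half[of x] half[of "1 - x"] sym_pos_solD(4)[OF u that] sym_pos_solD(4)[OF v that] that by (cases "x \<le> 1/2") auto
  then have "(\<lambda>x. u (max 0 (min 1 x))) = (\<lambda>x. v (max 0 (min 1 x)))" by auto
  then show ?thesis by (simp add: emb01_def)
qed

lemma sym_pos_sol_le_norm:
  assumes "sym_pos_sol p h lam u" "x \<in> {0..1}"
  shows "0 \<le> u x" "u x \<le> norm (emb01 u)"
proof -
  show "0 \<le> u x" by (rule sym_pos_solD(3)[OF assms])
  show "u x \<le> norm (emb01 u)"
    using norm_bounded[of "emb01 u" x] assms(2) emb01_apply[OF sym_pos_solD(5)[OF assms(1)], of x] by auto
qed

lemma sym_pos_sol_lam_bounds:
  assumes "sym_pos_sol p h lam u"
  shows "lam < pi\<^sup>2" "pi\<^sup>2 - lam \<le> norm (emb01 u) powr (p - 1)"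
proof -
  obtain u' where u': "half_sol p ((1-h)/2) lam u u'" using sym_pos_solD(1)[OF assms] by blast
  show "lam < pi\<^sup>2" by (rule half_sol_lam_bounds(1)[OF p interface_bounds u' sym_pos_solD(2)[OF assms]])
  show "pi\<^sup>2 - lam \<le> norm (emb01 u) powr (p - 1)"
    by (rule half_sol_lam_bounds(2)[OF p interface_bounds u' sym_pos_solD(2)[OF assms]]) (use sym_pos_sol_le_norm[OF assms] in auto)
qed

text \<open>The slope vanishes at the midpoint and changes at a rate bounded by the right-hand side,
  so a sup bound on \<open>u\<close> alone controls \<open>u'\<close>. This supplies both
  equicontinuity and the bound in \<open>C^1\<close>.\<close>

lemma sym_pos_sol_deriv_bound:
  assumes u: "sym_pos_sol p h lam u" and M: "norm (emb01 u) \<le> M"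
  obtains u' where "int_sol p h lam u u'" "u' (1/2) = 0"
    "\<And>x. x \<in> {0..1} \<Longrightarrow> \<bar>rhs p h lam u x\<bar> \<le> \<bar>lam\<bar> * M + M powr p"
    "\<And>x. x \<in> {0..1} \<Longrightarrow> \<bar>u' x\<bar> \<le> \<bar>lam\<bar> * M + M powr p"
proof -
  define B where "B = \<bar>lam\<bar> * M + M powr p"
  have M0: "0 \<le> M" using M norm_ge_zero order_trans by blast
  then have B0: "0 \<le> B" by (simp add: B_def)
  obtain u' where u': "int_sol p h lam u u'" "half_sol p ((1-h)/2) lam u u'"
    using sym_pos_solD(1)[OF u] by blast
  have bound: "\<bar>rhs p h lam u x\<bar> \<le> B" if "x \<in> {0..1}" for x
    unfolding B_def using sym_pos_sol_le_norm[OF u that] M p by (intro rhs_bound) auto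
  have half: "u' (1/2) = 0" using u'(2) by (simp add: half_sol_def)
  have ub: "\<bar>u' x\<bar> \<le> B" if "x \<in> {0..1}" for x
  proof -
    have "\<bar>u' x - u' (1/2)\<bar> \<le> B * \<bar>x - 1/2\<bar>"
      by (rule has_integral_bounded_imp_Lipschitz[of "rhs p h lam u"]) (use u' bound that in \<open>auto simp: int_sol_def\<close>)
    also have "\<dots> \<le> B * 1" using B0 that by (intro mult_left_mono) (auto simp: abs_le_iff)
    finally show ?thesis using half by simp
  qed
  show ?thesis by (rule that[OF u'(1) half bound[unfolded B_def] ub[unfolded B_def]])
qed

lemma sym_pos_sol_Lipschitz:
  assumes u: "sym_pos_sol p h lam u" and M: "norm (emb01 u) \<le> M" and xy: "x \<in> {0..1}" "y \<in> {0..1}"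
  shows "\<bar>emb01 u x - emb01 u y\<bar> \<le> (\<bar>lam\<bar> * M + M powr p) * \<bar>x - y\<bar>"
proof -
  obtain u' where u': "int_sol p h lam u u'" "\<And>x. x \<in> {0..1} \<Longrightarrow> \<bar>u' x\<bar> \<le> \<bar>lam\<bar> * M + M powr p"
    using sym_pos_sol_deriv_bound[OF u M] by blast
  have "norm (u x - u y) \<le> (\<bar>lam\<bar> * M + M powr p) * norm (x - y)"
    by (rule field_differentiable_bound[of "{0..1}"]) (use u' xy in \<open>auto simp: int_sol_def\<close>)
  then show ?thesis using emb01_apply[OF int_sol_continuous[OF u'(1)]] xy by simp
qed

text \<open>Only the functions are assumed to converge. Dominated convergence gives the limit of the
  slope increments, the condition at 1/2 fixes the slopes themselves, and a second use of dominated
  convergence identifies their limit as the derivative of \<open>g\<close>.\<close>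

lemma int_sol_limit:
  assumes u: "\<And>n. int_sol p h (l n) (u n) (u' n)" and half: "\<And>n. u' n (1/2) = 0"
    and bound: "\<And>n x. x \<in> {0..1} \<Longrightarrow> \<bar>rhs p h (l n) (u n) x\<bar> \<le> B" "\<And>n x. x \<in> {0..1} \<Longrightarrow> \<bar>u' n x\<bar> \<le> B"
    and nn: "\<And>n x. x \<in> {0..1} \<Longrightarrow> 0 \<le> u n x"
    and lim: "l \<longlonglongrightarrow> lam" "\<And>x. x \<in> {0..1} \<Longrightarrow> (\<lambda>n. u n x) \<longlonglongrightarrow> g x"
  obtains w where "int_sol p h lam g w"
proof -
  have int: "(rhs p h (l n) (u n) has_integral (u' n 0 - u' n x)) {0..x}" if "x \<in> {0..1}" for n x
    using u that by (simp add: int_sol_def)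
  have rlim: "(\<lambda>n. rhs p h (l n) (u n) x) \<longlonglongrightarrow> rhs p h lam g x" if "x \<in> {0..1}" for x
    unfolding rhs_def using p lim that nn by (intro tendsto_intros tendsto_powr2) auto
  define I where "I x = integral {0..x} (rhs p h lam g)" for x
  have rint: "rhs p h lam g integrable_on {0..x}" and Ilim: "(\<lambda>n. u' n 0 - u' n x) \<longlonglongrightarrow> I x"
    if x: "x \<in> {0..1}" for x
  proof -
    have *: "rhs p h (l n) (u n) integrable_on {0..x}" for n using int[OF x] by blast
    have c: "(\<lambda>_. B) integrable_on {0..x}" by (rule integrable_const_ivl)
    show "rhs p h lam g integrable_on {0..x}"
      by (rule dominated_convergence(1)[where f = "\<lambda>n. rhs p h (l n) (u n)", OF * c]) (use x bound rlim in auto)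
    have "(\<lambda>n. integral {0..x} (rhs p h (l n) (u n))) \<longlonglongrightarrow> I x"
      unfolding I_def by (rule dominated_convergence(2)[where f = "\<lambda>n. rhs p h (l n) (u n)", OF * c]) (use x bound rlim in auto)
    then show "(\<lambda>n. u' n 0 - u' n x) \<longlonglongrightarrow> I x" using integral_unique[OF int[OF x]] by simp
  qed
  \<comment> \<open>Normalised to vanish at 1/2, like every \<open>u' n\<close>.\<close>
  define w where "w x = I (1/2) - I x" for x
  have wlim: "(\<lambda>n. u' n x) \<longlonglongrightarrow> w x" if "x \<in> {0..1}" for x
    using tendsto_diff[OF Ilim[of "1/2"] Ilim[OF that]] half by (simp add: w_def)
  have wint: "(rhs p h lam g has_integral (w 0 - w x)) {0..x}" if "x \<in> {0..1}" for x
    using rint[OF that] by (simp add: w_def I_def has_integral_integral)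
  have rb: "\<bar>rhs p h lam g x\<bar> \<le> B" if "x \<in> {0..1}" for x
    using tendsto_upperbound[OF tendsto_rabs[OF rlim[OF that]]] bound(1)[OF that] by (auto simp: always_eventually)
  have "B-lipschitz_on {0..1} w"
    using has_integral_bounded_imp_Lipschitz[OF wint rb] rb[of 0] by (auto simp: lipschitz_on_def dist_real_def)
  then have contw: "continuous_on {0..1} w" by (rule lipschitz_on_continuous_on)
  have uint: "(u' n has_integral (u n x)) {0..x}" if x: "x \<in> {0..1}" for n x
  proof -
    have "(u' n has_integral (u n x - u n 0)) {0..x}"
    proof (rule fundamental_theorem_of_calculus)
      show "(u n has_vector_derivative u' n y) (at y within {0..x})" if "y \<in> {0..x}" for y
      proof -
        have "(u n has_real_derivative u' n y) (at y within {0..1})"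
          using u[of n] that x by (simp add: int_sol_def)
        then have "(u n has_real_derivative u' n y) (at y within {0..x})"
          by (rule DERIV_subset) (use x in auto)
        then show ?thesis by (simp add: has_real_derivative_iff_has_vector_derivative)
      qed
    qed (use x in auto)
    then show ?thesis using u[of n] by (simp add: int_sol_def)
  qed
  have g: "(w has_integral (g x)) {0..x}" if x: "x \<in> {0..1}" for x
  proof -
    have *: "u' n integrable_on {0..x}" for n using uint[OF x] by blast
    have c: "(\<lambda>_. B) integrable_on {0..x}" by (rule integrable_const_ivl)
    have wi: "w integrable_on {0..x}"
      by (rule dominated_convergence(1)[where f = u', OF * c]) (use x bound wlim in auto)
    have "(\<lambda>n. integral {0..x} (u' n)) \<longlonglongrightarrow> integral {0..x} w"
      by (rule dominated_convergence(2)[where f = u', OF * c]) (use x bound wlim in auto)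
    then have "(\<lambda>n. u n x) \<longlonglongrightarrow> integral {0..x} w" using integral_unique[OF uint[OF x]] by simp
    then have "integral {0..x} w = g x" using lim(2)[OF x] by (rule LIMSEQ_unique)
    then show ?thesis using wi by (metis integrable_integral)
  qed
  have g0: "g 0 = 0" using g[of 0] by (auto dest: has_integral_unique[OF has_integral_refl(2)])
  have "(g has_real_derivative w x) (at x within {0..1})" if x: "x \<in> {0..1}" for x
  proof -
    have "((\<lambda>x. - g x) has_real_derivative - w x) (at x within {0..1})"
      by (rule integral_form_has_derivative[OF contw _ x]) (use g g0 in auto)
    from DERIV_minus[OF this] show ?thesis by simp
  qed
  moreover have "g 1 = 0"
  proof -
    have "(\<lambda>n. u n 1) = (\<lambda>n. 0)" using u by (auto simp: int_sol_def)
    then have "(\<lambda>n. 0) \<longlonglongrightarrow> g 1" using lim(2)[of 1] by simp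
    then show ?thesis by (simp add: LIMSEQ_const_iff)
  qed
  ultimately show ?thesis using that[of w] wint g0 by (simp add: int_sol_def)
qed

text \<open>A limit of solutions is a nonnegative symmetric solution. Either it is positive, or a
  zero in \<open>(0, 1)\<close> makes it vanish identically; then
  \<open>0 < pi^2 - l n \<le> norm (emb01 (u n)) powr (p - 1)\<close> tends to 0 and pins down
  \<open>lam\<close>.\<close>

lemma closure_S_sym:
  assumes "(lam, f) \<in> closure (S_sym p h)"
  shows "(lam = pi\<^sup>2 \<and> f = 0) \<or> (\<exists>u. sym_pos_sol p h lam u \<and> f = emb01 u)"
proof -
  obtain s where s: "\<And>n. s n \<in> S_sym p h" "s \<longlonglongrightarrow> (lam, f)"
    using assms unfolding closure_sequential by auto
  have "\<exists>u. sym_pos_sol p h (fst (s n)) u \<and> snd (s n) = emb01 u" for n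
    using s(1)[of n] by (auto simp: S_sym_def)
  then obtain u where u: "\<And>n. sym_pos_sol p h (fst (s n)) (u n)" "\<And>n. snd (s n) = emb01 (u n)" by metis
  define l where "l n = fst (s n)" for n
  have llim: "l \<longlonglongrightarrow> lam" unfolding l_def using tendsto_fst[OF s(2)] by simp
  have flim: "(\<lambda>n. emb01 (u n)) \<longlonglongrightarrow> f" using tendsto_snd[OF s(2)] u(2) by simp
  have sol: "sym_pos_sol p h (l n) (u n)" for n using u by (simp add: l_def)
  have app: "emb01 (u n) x = u n (max 0 (min 1 x))" for n x
    by (rule emb01_apply[OF sym_pos_solD(5)[OF sol]])
  have pw: "(\<lambda>n. u n (max 0 (min 1 x))) \<longlonglongrightarrow> f x" for x
    using tendsto_uniform_limitI[OF tendsto_bcontfun_uniform_limit[OF flim], of x] app by simp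
  \<comment> \<open>The limit is taken among functions on the whole line; to be in the image of
    \<open>emb01\<close> it must be constant on each side of \<open>[0, 1]\<close>.\<close>
  have clamp: "f x = f (max 0 (min 1 x))" for x
  proof (rule LIMSEQ_unique[OF pw[of x]])
    have "max 0 (min 1 (max 0 (min 1 x))) = max 0 (min 1 x)" by auto
    then show "(\<lambda>n. u n (max 0 (min 1 x))) \<longlonglongrightarrow> f (max 0 (min 1 x))"
      using pw[of "max 0 (min 1 x)"] by (simp only:)
  qed
  have gl: "(\<lambda>n. u n x) \<longlonglongrightarrow> f x" if "x \<in> {0..1}" for x
    using pw[of x] that by simp
  obtain M where M: "\<And>n. norm (emb01 (u n)) \<le> M"
    using convergent_imp_Bseq[OF convergentI[OF flim]] by (auto simp: Bseq_def)
  obtain L where L: "\<And>n. \<bar>l n\<bar> \<le> L"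
    using convergent_imp_Bseq[OF convergentI[OF llim]] by (auto simp: Bseq_def)
  define B where "B = L * M + M powr p"
  have M0: "0 \<le> M" using M[of 0] norm_ge_zero order_trans by blast
  have "\<exists>u'. int_sol p h (l n) (u n) u' \<and> u' (1/2) = 0 \<and> (\<forall>x\<in>{0..1}. \<bar>rhs p h (l n) (u n) x\<bar> \<le> B) \<and>
      (\<forall>x\<in>{0..1}. \<bar>u' x\<bar> \<le> B)" for n
  proof -
    obtain u' where u': "int_sol p h (l n) (u n) u'" "u' (1/2) = 0"
      "\<And>x. x \<in> {0..1} \<Longrightarrow> \<bar>rhs p h (l n) (u n) x\<bar> \<le> \<bar>l n\<bar> * M + M powr p"
      "\<And>x. x \<in> {0..1} \<Longrightarrow> \<bar>u' x\<bar> \<le> \<bar>l n\<bar> * M + M powr p"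
      using sym_pos_sol_deriv_bound[OF sol[of n] M[of n]] by blast
    have "\<bar>l n\<bar> * M + M powr p \<le> B" unfolding B_def using L[of n] M0 by (simp add: mult_right_mono)
    then show ?thesis using u' by (meson order_trans)
  qed
  then obtain u' where u': "\<And>n. int_sol p h (l n) (u n) (u' n)" "\<And>n. u' n (1/2) = 0"
    "\<And>n x. x \<in> {0..1} \<Longrightarrow> \<bar>rhs p h (l n) (u n) x\<bar> \<le> B" "\<And>n x. x \<in> {0..1} \<Longrightarrow> \<bar>u' n x\<bar> \<le> B"
    by metis
  have unn: "0 \<le> u n x" if "x \<in> {0..1}" for n x using sym_pos_sol_le_norm(1)[OF sol that] .
  obtain w where w: "int_sol p h lam f w"
    using int_sol_limit[OF u' unn llim gl] by blast
  have fnn: "0 \<le> f x" if "x \<in> {0..1}" for x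
    by (rule LIMSEQ_le_const[OF gl[OF that]]) (use unn that in auto)
  have fsym: "f x = f (1 - x)" if "x \<in> {0..1}" for x
  proof (rule LIMSEQ_unique[OF gl[OF that]])
    have "u n (1 - x) = u n x" for n using sol[of n] that unfolding sym_pos_sol_def by fastforce
    then show "(\<lambda>n. u n x) \<longlonglongrightarrow> f (1 - x)" using gl[of "1 - x"] that by simp
  qed
  have half: "half_sol p ((1-h)/2) lam f w" by (rule int_sol_half_sol[OF w fnn fsym])
  have emb: "f = emb01 f"
  proof (rule bcontfun_eqI)
    show "f x = emb01 f x" for x
      using emb01_apply[OF int_sol_continuous[OF w], of x] clamp[of x] by (simp only:)
  qed
  show ?thesis
  proof (cases "\<forall>x\<in>{0<..<1}. 0 < f x")
    case True
    then have "sym_pos_sol p h lam f"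
      unfolding sym_pos_sol_def
      by (intro conjI ballI int_sol_imp_is_sol[OF p h w fnn] fsym) auto
    then show ?thesis using emb by blast
  next
    case False
    then obtain z where "z \<in> {0<..<1}" "\<not> 0 < f z" by blast
    then have z: "z \<in> {0<..<1}" "f z = 0" using fnn[of z] by auto
    \<comment> \<open>Symmetry moves the zero into the left half, where \<open>half_sol_eq_0\<close>
      applies.\<close>
    define x0 where "x0 = min z (1 - z)"
    have x0: "0 < x0" "x0 \<le> 1/2" "f x0 = 0" using z fsym[of z] by (auto simp: x0_def min_def)
    have zero: "f x = 0" if "x \<in> {0..1/2}" for x
      by (rule half_sol_eq_0[OF p interface_bounds half x0 that])
    have zero1: "f x = 0" if "x \<in> {0..1}" for x
      using zero[of x] zero[of "1 - x"] fsym[OF that] that by (cases "x \<le> 1/2") auto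
    have "f = 0"
    proof (rule bcontfun_eqI)
      show "f x = (0 :: real \<Rightarrow>\<^sub>C real) x" for x
        unfolding clamp[of x] using zero1[of "max 0 (min 1 x)"] by simp
    qed
    moreover have "lam = pi\<^sup>2"
    proof -
      have "(\<lambda>n. norm (emb01 (u n)) powr (p - 1)) \<longlonglongrightarrow> norm f powr (p - 1)"
        by (rule tendsto_powr2) (use p in \<open>auto intro!: tendsto_norm flim tendsto_const\<close>)
      then have "(\<lambda>n. norm (emb01 (u n)) powr (p - 1)) \<longlonglongrightarrow> 0" using \<open>f = 0\<close> p by simp
      then have "(\<lambda>n. pi\<^sup>2 - l n) \<longlonglongrightarrow> 0"
        by (rule tendsto_sandwich[OF _ _ tendsto_const, rotated 2])
          (use sym_pos_sol_lam_bounds[OF sol] in \<open>auto intro!: always_eventually less_imp_le\<close>)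
      moreover have "(\<lambda>n. pi\<^sup>2 - l n) \<longlonglongrightarrow> pi\<^sup>2 - lam" by (intro tendsto_intros llim)
      ultimately have "pi\<^sup>2 - lam = 0" by (rule LIMSEQ_unique[rotated])
      then show ?thesis by simp
    qed
    ultimately show ?thesis by simp
  qed
qed

text \<open>Bounds on \<open>lam\<close> and on the norm give a common Lipschitz constant, so
  Arzela-Ascoli yields a convergent subsequence; closedness of \<open>G\<close> keeps its limit in
  the set.\<close>

lemma compact_bounded_part:
  assumes "closed G" "G \<subseteq> closure (S_sym p h)"
  shows "compact (G \<inter> {z. \<bar>fst z\<bar> \<le> M \<and> norm (snd z) \<le> M})"
  unfolding compact_def
proof (intro allI impI)
  define K where "K = G \<inter> {z. \<bar>fst z\<bar> \<le> M \<and> norm (snd z) \<le> M}"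
  have "closed {z :: real \<times> (real \<Rightarrow>\<^sub>C real). \<bar>fst z\<bar> \<le> M \<and> norm (snd z) \<le> M}"
    by (intro closed_Collect_conj closed_Collect_le continuous_intros)
  then have clK: "closed K" unfolding K_def using assms(1) by (rule closed_Int[rotated])
  fix s :: "nat \<Rightarrow> real \<times> (real \<Rightarrow>\<^sub>C real)"
  assume "\<forall>n. s n \<in> G \<inter> {z. \<bar>fst z\<bar> \<le> M \<and> norm (snd z) \<le> M}"
  then have s: "s n \<in> K" for n by (simp add: K_def)
  define f where "f n = snd (s n)" for n
  have M0: "0 \<le> M" using s[of 0] by (auto simp: K_def)
  define L where "L = M * M + M powr p"
  have L0: "0 \<le> L" using M0 by (simp add: L_def)
  have props: "f n x = f n (max 0 (min 1 x)) \<and>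
      (x \<in> {0..1} \<and> y \<in> {0..1} \<longrightarrow> \<bar>f n x - f n y\<bar> \<le> L * \<bar>x - y\<bar>)" for n x y
  proof -
    have "(fst (s n), f n) \<in> closure (S_sym p h)" using s[of n] assms(2) by (auto simp: K_def f_def)
    from closure_S_sym[OF this] show ?thesis
    proof (elim disjE exE conjE)
      assume "f n = 0" then show ?thesis using L0 by simp
    next
      fix u assume u: "sym_pos_sol p h (fst (s n)) u" "f n = emb01 u"
      have "continuous_on {0..1} u" by (rule sym_pos_solD(5)[OF u(1)])
      then have "f n x = f n (max 0 (min 1 x))" unfolding u(2) by (simp add: emb01_apply)
      moreover have "\<bar>f n x - f n y\<bar> \<le> L * \<bar>x - y\<bar>" if "x \<in> {0..1}" "y \<in> {0..1}"
      proof -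
        have "norm (emb01 u) \<le> M" "\<bar>fst (s n)\<bar> \<le> M" using s[of n] u(2) by (auto simp: K_def f_def)
        then have "\<bar>f n x - f n y\<bar> \<le> (\<bar>fst (s n)\<bar> * M + M powr p) * \<bar>x - y\<bar>"
          unfolding u(2) using sym_pos_sol_Lipschitz[OF u(1) _ that] by blast
        also have "\<dots> \<le> L * \<bar>x - y\<bar>"
          unfolding L_def using \<open>\<bar>fst (s n)\<bar> \<le> M\<close> M0 by (intro mult_right_mono add_right_mono) auto
        finally show ?thesis .
      qed
      ultimately show ?thesis by blast
    qed
  qed
  have "bounded (range (\<lambda>n. fst (s n)))"
    unfolding bounded_iff using s by (auto simp: K_def)
  then obtain a r where r: "strict_mono (r :: nat \<Rightarrow> nat)" "((\<lambda>n. fst (s n)) \<circ> r) \<longlonglongrightarrow> a"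
    using bounded_imp_convergent_subsequence by blast
  obtain l k where k: "strict_mono (k :: nat \<Rightarrow> nat)" "(\<lambda>n. f (r (k n))) \<longlonglongrightarrow> l"
  proof (rule Lipschitz_convergent_subseq[of "\<lambda>n. f (r n)" M L])
    show "norm (f (r n)) \<le> M" for n using s[of "r n"] by (auto simp: K_def f_def)
  qed (use props that in auto)
  have "(\<lambda>n. fst (s (r (k n)))) \<longlonglongrightarrow> a"
    using LIMSEQ_subseq_LIMSEQ[OF r(2) k(1)] by (simp add: o_def)
  then have "(\<lambda>n. (fst (s (r (k n))), snd (s (r (k n))))) \<longlonglongrightarrow> (a, l)"
    using k(2) unfolding f_def by (rule tendsto_Pair)
  then have lim: "(s \<circ> (r \<circ> k)) \<longlonglongrightarrow> (a, l)" by (simp add: o_def)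
  moreover have "(a, l) \<in> K"
    by (rule closed_sequentially[OF clK _ lim]) (simp add: s)
  moreover have "strict_mono (r \<circ> k)" using r(1) k(1) by (rule strict_mono_o)
  ultimately show "\<exists>l\<in>G \<inter> {z. \<bar>fst z\<bar> \<le> M \<and> norm (snd z) \<le> M}. \<exists>r. strict_mono r \<and> (s \<circ> r) \<longlonglongrightarrow> l"
    unfolding K_def by blast
qed

end

section \<open>The component of symmetric positive solutions\<close>

theorem theorem2p2:
  fixes p h :: real
  assumes hp: "p > 1"
    and hh: "0 < h" "h < 1"
    and hC0: "(pi\<^sup>2, 0) \<in> C_hs p h"
    and hproj: "fst ` C_hs p h = {..pi\<^sup>2}"
  shows
    \<comment> \<open>(a)\<close>
    "(\<forall>lam f. (lam, f) \<in> C_hs p h \<longrightarrow>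
        (lam = pi\<^sup>2 \<and> f = 0) \<or>
        (lam < pi\<^sup>2 \<and> (\<exists>u. sym_pos_sol p h lam u \<and> f = emb01 u) \<and>
           (\<forall>v. sym_pos_sol p h lam v \<longrightarrow> emb01 v = f)))
     \<comment> \<open>(b)\<close>
     \<and> (\<forall>\<sigma>\<le>pi\<^sup>2. (((\<lambda>lam. norm (U p h lam)) \<longlongrightarrow> 0) (at \<sigma> within {..<pi\<^sup>2}))
                      \<longleftrightarrow> \<sigma> = pi\<^sup>2)
     \<comment> \<open>(c)\<close>
     \<and> (\<forall>lam0<pi\<^sup>2. \<exists>M. \<forall>lam\<in>{lam0..<pi\<^sup>2}. \<forall>x\<in>{0..1::real}.
           \<bar>U p h lam x\<bar> \<le> M \<and>
           \<bar>vector_derivative (U p h lam) (at x within {0..1})\<bar> \<le> M)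
     \<and> filterlim (\<lambda>lam. norm (U p h lam)) at_top at_bot
     \<comment> \<open>(d)\<close>
     \<and> continuous_on {..pi\<^sup>2} (Uext p h)
     \<and> C_hs p h = (\<lambda>lam. (lam, Uext p h lam)) ` {..pi\<^sup>2}
     \<comment> \<open>inclusion\<close>
     \<and> C_hs p h \<subseteq> C_h p h"
proof -
  define C where "C = C_hs p h"
  have Csub: "C \<subseteq> closure (S_sym p h)"
    unfolding C_def C_hs_def by (rule connected_component_subset)
  have Cclosed: "closed C"
    unfolding C_def C_hs_def by (intro closed_connected_component closed_closure)
  have Cconn: "connected C"
    unfolding C_def C_hs_def by (rule connected_connected_component)
  have a: "(lam = pi\<^sup>2 \<and> f = 0) \<or>
      (lam < pi\<^sup>2 \<and> (\<exists>u. sym_pos_sol p h lam u \<and> f = emb01 u) \<and>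
         (\<forall>v. sym_pos_sol p h lam v \<longrightarrow> emb01 v = f))" if "(lam, f) \<in> C" for lam f
    using closure_S_sym[OF hp hh, of lam f] Csub that sym_pos_sol_lam_bounds(1)[OF hp hh]
      sym_pos_sol_unique[OF hp hh] by blast
  have ex: "\<exists>u. sym_pos_sol p h lam u \<and> U p h lam = emb01 u \<and> (lam, U p h lam) \<in> C"
    if lam: "lam < pi\<^sup>2" for lam
  proof -
    have "lam \<in> fst ` C" using hproj lam by (simp add: C_def)
    then obtain f where f: "(lam, f) \<in> C" by auto
    then obtain u where u: "sym_pos_sol p h lam u" "f = emb01 u" using a[OF f] lam by auto
    \<comment> \<open>Existence and uniqueness at this \<open>lam\<close> make the definite
      description in \<open>U\<close> denote.\<close>
    have "U p h lam = emb01 u"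
      unfolding U_def using u(1) sym_pos_sol_unique[OF hp hh] by (intro the_equality) blast+
    then show ?thesis using u f by auto
  qed
  \<comment> \<open>The projection onto the full half-line provides a point of \<open>C\<close> over
    every \<open>lam\<close>, and alternative (a) allows only one.\<close>
  have graph: "C = (\<lambda>lam. (lam, Uext p h lam)) ` {..pi\<^sup>2}"
  proof (intro equalityI subsetI)
    fix z assume z: "z \<in> C"
    obtain lam f where zz: "z = (lam, f)" by fastforce
    have "lam \<le> pi\<^sup>2 \<and> f = Uext p h lam"
      using a[of lam f] z ex[of lam] unfolding zz Uext_def by (metis less_eq_real_def less_irrefl)
    then show "z \<in> (\<lambda>lam. (lam, Uext p h lam)) ` {..pi\<^sup>2}" unfolding zz by blast
  next
    fix z assume "z \<in> (\<lambda>lam. (lam, Uext p h lam)) ` {..pi\<^sup>2}"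
    then obtain lam where lam: "lam \<le> pi\<^sup>2" "z = (lam, Uext p h lam)" by blast
    show "z \<in> C"
      using lam ex[of lam] hC0 by (cases "lam = pi\<^sup>2") (auto simp: Uext_def C_def)
  qed
  \<comment> \<open>Continuity comes from the connectedness of the component and the compactness of
    its bounded parts.\<close>
  have cont: "continuous_on {..pi\<^sup>2} (Uext p h)"
  proof (rule connected_graph_imp_continuous)
    show "connected ((\<lambda>lam. (lam, Uext p h lam)) ` {..pi\<^sup>2})" using Cconn graph by simp
    show "compact ((\<lambda>lam. (lam, Uext p h lam)) ` {..pi\<^sup>2} \<inter> {z. \<bar>fst z\<bar> \<le> M \<and> norm (snd z) \<le> M})" for M
      unfolding graph[symmetric] by (rule compact_bounded_part[OF hp hh Cclosed Csub])
  qed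
  \<comment> \<open>The eigenfunction estimate solved for the norm. It keeps the solutions away from
    0 at every \<open>lam < pi^2\<close> and drives the blow-up at minus infinity.\<close>
  have lower: "(pi\<^sup>2 - lam) powr (1 / (p - 1)) \<le> norm (U p h lam)" if lam: "lam < pi\<^sup>2" for lam
  proof -
    have "pi\<^sup>2 - lam \<le> norm (U p h lam) powr (p - 1)"
      using ex[OF lam] sym_pos_sol_lam_bounds(2)[OF hp hh] by metis
    then have "(pi\<^sup>2 - lam) powr (1 / (p - 1)) \<le> (norm (U p h lam) powr (p - 1)) powr (1 / (p - 1))"
      using lam hp by (intro powr_mono2) auto
    also have "\<dots> = norm (U p h lam)" using hp by (simp add: powr_powr)
    finally show ?thesis .
  qed
  \<comment> \<open>\<open>U\<close> and \<open>Uext\<close> agree below \<open>pi^2\<close>, so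
    this one limit serves interior points and, with value 0, the endpoint.\<close>
  have U_lim: "((\<lambda>lam. norm (U p h lam)) \<longlongrightarrow> norm (Uext p h \<sigma>)) (at \<sigma> within {..<pi\<^sup>2})"
    if "\<sigma> \<le> pi\<^sup>2" for \<sigma>
  proof -
    have "(Uext p h \<longlongrightarrow> Uext p h \<sigma>) (at \<sigma> within {..pi\<^sup>2})"
      using cont that by (simp add: continuous_on)
    then have "(Uext p h \<longlongrightarrow> Uext p h \<sigma>) (at \<sigma> within {..<pi\<^sup>2})"
      by (rule tendsto_within_subset) auto
    then have "((\<lambda>lam. norm (Uext p h lam)) \<longlongrightarrow> norm (Uext p h \<sigma>)) (at \<sigma> within {..<pi\<^sup>2})"
      by (rule tendsto_norm)
    moreover have "\<forall>\<^sub>F lam in at \<sigma> within {..<pi\<^sup>2}. norm (Uext p h lam) = norm (U p h lam)"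
      by (auto simp: eventually_at_filter Uext_def)
    ultimately show ?thesis by (rule Lim_transform_eventually)
  qed
  have b: "(((\<lambda>lam. norm (U p h lam)) \<longlongrightarrow> 0) (at \<sigma> within {..<pi\<^sup>2})) \<longleftrightarrow> \<sigma> = pi\<^sup>2"
    if \<sigma>: "\<sigma> \<le> pi\<^sup>2" for \<sigma>
  proof
    assume lim: "((\<lambda>lam. norm (U p h lam)) \<longlongrightarrow> 0) (at \<sigma> within {..<pi\<^sup>2})"
    show "\<sigma> = pi\<^sup>2"
    proof (rule ccontr)
      assume "\<sigma> \<noteq> pi\<^sup>2"
      then have lt: "\<sigma> < pi\<^sup>2" using \<sigma> by simp
      then have "at \<sigma> within {..<pi\<^sup>2} = at \<sigma>" by (intro at_within_open) auto
      then have "norm (Uext p h \<sigma>) = 0"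
        using U_lim[OF \<sigma>] lim by (metis LIM_unique)
      then have "norm (U p h \<sigma>) = 0" using lt by (simp add: Uext_def)
      moreover have "0 < (pi\<^sup>2 - \<sigma>) powr (1 / (p - 1))" using lt by simp
      ultimately show False using lower[OF lt] by linarith
    qed
  next
    assume "\<sigma> = pi\<^sup>2"
    then show "((\<lambda>lam. norm (U p h lam)) \<longlongrightarrow> 0) (at \<sigma> within {..<pi\<^sup>2})"
      using U_lim[of "pi\<^sup>2"] by (simp add: Uext_def)
  qed
  have c1: "\<exists>M. \<forall>lam\<in>{lam0..<pi\<^sup>2}. \<forall>x\<in>{0..1::real}. \<bar>U p h lam x\<bar> \<le> M \<and>
      \<bar>vector_derivative (U p h lam) (at x within {0..1})\<bar> \<le> M" for lam0
  proof -
    \<comment> \<open>Setting \<open>Uext\<close> to 0 at \<open>pi^2\<close> allows the parameter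
      interval to be closed, hence compact.\<close>
    have "compact (Uext p h ` {lam0..pi\<^sup>2})"
      by (intro compact_continuous_image continuous_on_subset[OF cont]) auto
    then have "bounded (Uext p h ` {lam0..pi\<^sup>2})" by (rule compact_imp_bounded)
    then obtain M where M: "\<forall>lam\<in>{lam0..pi\<^sup>2}. norm (Uext p h lam) \<le> M"
      by (auto simp: bounded_iff)
    \<comment> \<open>A bound for \<open>\<bar>lam\<bar>\<close> on the whole interval from
      \<open>lam0\<close> to \<open>pi^2\<close>, making the slope bound uniform.\<close>
    define L where "L = \<bar>lam0\<bar> + pi\<^sup>2"
    define B where "B = L * M + M powr p"
    have "\<bar>U p h lam x\<bar> \<le> M + B \<and> \<bar>vector_derivative (U p h lam) (at x within {0..1})\<bar> \<le> M + B"
      if lam: "lam \<in> {lam0..<pi\<^sup>2}" and x: "x \<in> {0..1::real}" for lam x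
    proof -
      obtain u where u: "sym_pos_sol p h lam u" "U p h lam = emb01 u" using ex[of lam] lam by auto
      have nM: "norm (emb01 u) \<le> M" using M[rule_format, of lam] lam u(2) by (simp add: Uext_def)
      have M0: "0 \<le> M" using nM norm_ge_zero order_trans by blast
      have "lam0 \<le> lam" "lam < pi\<^sup>2" using lam by auto
      then have "\<bar>lam\<bar> \<le> L" using zero_le_power2[of pi] unfolding L_def by linarith
      then have LB: "\<bar>lam\<bar> * M + M powr p \<le> B" using M0 by (simp add: B_def mult_right_mono)
      obtain u' where u': "int_sol p h lam u u'"
        "\<And>x. x \<in> {0..1} \<Longrightarrow> \<bar>u' x\<bar> \<le> \<bar>lam\<bar> * M + M powr p"
        using sym_pos_sol_deriv_bound[OF hp hh u(1) nM] by blast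
      have app: "U p h lam y = u y" if "y \<in> {0..1}" for y
        using emb01_apply[OF int_sol_continuous[OF u'(1)], of y] that u(2) by simp
      have "(u has_real_derivative u' x) (at x within {0..1})" using u'(1) x by (simp add: int_sol_def)
      then have "(U p h lam has_real_derivative u' x) (at x within {0..1})"
        by (rule has_field_derivative_transform_within[OF _ zero_less_one x]) (simp add: app)
      then have "vector_derivative (U p h lam) (at x within {0..1}) = u' x"
        by (intro vector_derivative_within_closed_interval[OF zero_less_one x])
          (simp add: has_real_derivative_iff_has_vector_derivative)
      moreover have "\<bar>U p h lam x\<bar> \<le> M" using norm_bounded[of "U p h lam" x] nM u(2) by simp
      ultimately show ?thesis using u'(2)[OF x] LB M0 abs_ge_zero[of "u' x"] by linarith
    qed
    then show ?thesis by blast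
  qed
  have c2: "filterlim (\<lambda>lam. norm (U p h lam)) at_top at_bot"
  proof (rule filterlim_at_top_mono)
    show "filterlim (\<lambda>lam. (pi\<^sup>2 - lam) powr (1 / (p - 1))) at_top at_bot"
      using hp by real_asymp
    show "\<forall>\<^sub>F lam in at_bot. (pi\<^sup>2 - lam) powr (1 / (p - 1)) \<le> norm (U p h lam)"
      using eventually_gt_at_bot[of "pi\<^sup>2"] by eventually_elim (rule lower)
  qed
  \<comment> \<open>Positive symmetric solutions are nonnegative and nontrivial; closures and
    components through the same point grow with the set.\<close>
  have incl: "C \<subseteq> C_h p h"
  proof -
    have "S_sym p h \<subseteq> S_nn p h"
    proof
      fix z assume "z \<in> S_sym p h"
      then obtain lam u where z: "z = (lam, emb01 u)" and u: "sym_pos_sol p h lam u" by (auto simp: S_sym_def)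
      have "0 < u (1/2)" by (rule sym_pos_solD(2)[OF hp hh u]) auto
      moreover have "\<forall>x\<in>{0..1}. 0 \<le> u x" using sym_pos_solD(3)[OF hp hh u] by blast
      moreover have "is_sol p h lam u" using u unfolding sym_pos_sol_def by blast
      ultimately have "nonneg_nontriv_sol p h lam u"
        unfolding nonneg_nontriv_sol_def by (intro conjI bexI[of _ "1/2"]) auto
      then show "z \<in> S_nn p h" using z by (auto simp: S_nn_def)
    qed
    then show ?thesis
      unfolding C_def C_hs_def C_h_def by (intro connected_component_mono closure_mono)
  qed
  show ?thesis
    unfolding C_def[symmetric] by (intro conjI allI impI a b c1 c2 cont graph incl)
qed

end
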